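(* Assume that $b(\theta)\ge 0$ for every $\theta\in[0,1]$ and that the ideal-action ranges overlap, i.e. $y_P([0,1])\cap y_A([0,1])$ contains a nondegenerate interval (equivalently, under $b\ge 0$, $y_A(0)<y_P(1)$). Let $\bar\theta,\ d,\ \underline\theta,\ \mu^*,\ \tau^*,\ F^*$ be as defined in the context, and let $m^*:\Theta\to\Delta(\mathcal A)$ be a Borel probability kernel with mean function $\mu^*$ and variance function $\tau^*$. Then $m^*$ is robustly optimal, i.e. $m^*\in\mathcal M$ and $$\inf_{F\in\mathcal F(\Theta)}V(m^*,F)=\sup_{m\in\mathcal M}\ \inf_{F\in\mathcal F(\Theta)}V(m,F),$$ and the value of the robust problem is $$\sup_{m\in\mathcal M}\ \inf_{F\in\mathcal F(\Theta)}V(m,F)=V(m^*,F^* )=-d(\underline\theta)^2 .$$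
   Context: **Model.** $\Theta=[0,1]$; $\mathcal A\subset\mathbb R$ is a compact interval; $y_P,y_A:\Theta\to\mathcal A$ are continuously differentiable and strictly increasing (ideal-action functions of the principal $P$ and the agent $A$). The bias is $b(\theta):=y_A(\theta)-y_P(\theta)$; it is assumed to be either weakly increasing on $\Theta$ or weakly decreasing on $\Theta$, and there is at most one $\theta\in\Theta$ with $b(\theta)=0$. $\mathcal F(\Theta)$ is the set of CDFs of Borel probability distributions on $\Theta$. A mechanism is a Borel probability kernel $m:\Theta\to\Delta(\mathcal A)$, where $\Delta(\mathcal A)$ is the set of Borel probability distributions on $\mathcal A$; its mean and variance functions are $\mu_m(\hat\theta)=\int a\,dm(a\mid\hat\theta)$ and $\tau_m(\hat\theta)=\int (a-\mu_m(\hat\theta))^2\,dm(a\mid\hat\theta)$. For $j\in\{P,A\}$, $U_{j,m}(\theta,\hat\theta):=-\int (a-y_j(\theta))^2\,dm(a\mid\hat\theta)=-\tau_m(\hat\theta)-(\mu_m(\hat\theta)-y_j(\theta))^2$ and $U_{j,m}(\theta):=U_{j,m}(\theta,\theta)$. $\mathcal M$ is the set of incentive-compatible mechanisms, i.e. those with $U_{A,m}(\theta,\theta)\ge U_{A,m}(\theta,\hat\theta)$ for all $\theta,\hat\theta\in\Theta$. For $m\in\mathcal M$, $F\in\mathcal F(\Theta)$: $V(m,F):=\int_\Theta U_{P,m}(\theta)\,dF(\theta)$. **Construction** (for $b\ge0$ and $y_A(0)<y_P(1)$). Let $\bar\theta:=y_A^{-1}(y_P(1))\in(0,1]$. For $\theta\in[0,\bar\theta]$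 with $b(\theta)>0$ let $$d(\theta):=\frac{b(\bar\theta)}{2}\exp\Bigl(-\int_\theta^{\bar\theta}\frac{y_P'(t)}{b(t)}\,dt\Bigr)+\int_\theta^{\bar\theta}y_P'(t)\exp\Bigl(-\int_\theta^t\frac{y_P'(s)}{b(s)}\,ds\Bigr)dt .$$ If $b(1)=0$ (then $\bar\theta=1$), integrals with upper endpoint $1$ are improper integrals evaluated as one-sided limits, with $\exp(-\infty)=0$, and $d(1):=0$; the same convention applies to $F^*$ below. Let $$\underline\theta:=\inf\{\theta\in[0,\bar\theta]: b(\theta)>0,\ d(\theta)\le b(\theta)\}.$$ Define $$\mu^*(\theta)=\begin{cases}y_A(\theta),&0\le\theta<\underline\theta,\\ y_P(\theta)+d(\theta),&\underline\theta\le\theta\le\bar\theta,\\ \frac{y_P(\bar\theta)+y_P(1)}2,&\bar\theta<\theta\le1,\end{cases}\qquad \tau^*(\theta)=\begin{cases}0,&0\le\theta<\underline\theta,\\ d(\underline\theta)^2-d(\theta)^2,&\underline\theta\le\theta\le\bar\theta,\\ d(\underline\theta)^2-\frac{b(\bar\theta)^2}4,&\bar\theta<\theta\le1,\end{cases}$$ $$F^*(\theta)=\begin{cases}0,&\theta<\underline\theta,\\ 1-\dfrac{d(\underline\theta)}{b(\underline\theta)}\exp\Bigl(-\displaystyle\int_{\underline\theta}^{\min\{\theta,\bar\theta\}}\frac{y_A'(t)}{b(t)}\,dt\Bigr),&\underline\theta\le\theta<1,\\ 1,&\theta\ge1.\end{cases}$$ The action interval $\mathcal A$ is assumed large enough that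 a kernel into $\Delta(\mathcal A)$ with mean $\mu^*$ and variance $\tau^*$ exists (writing $\mathcal A=[\alpha_0,\beta_0]$: $\tau^*(\theta)\le(\mu^*(\theta)-\alpha_0)(\beta_0-\mu^*(\theta))$ for all $\theta$). *)

theory Defs
  imports "HOL-Probability.Probability"
begin

abbreviation Theta :: "real set" where
  "Theta \<equiv> {0..1}"

text \<open>Derivatives on the compact interval \<open>Theta\<close>; they are one-sided at the two endpoints.\<close>

definition dTheta :: "(real \<Rightarrow> real) \<Rightarrow> real \<Rightarrow> real" where
  "dTheta y t = vector_derivative y (at t within Theta)"

definition C1_on_Theta :: "(real \<Rightarrow> real) \<Rightarrow> bool" where
  "C1_on_Theta y \<longleftrightarrow> y differentiable_on Theta \<and> continuous_on Theta (dTheta y)"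

definition bias :: "(real \<Rightarrow> real) \<Rightarrow> (real \<Rightarrow> real) \<Rightarrow> real \<Rightarrow> real" where
  "bias yP yA \<theta> = yA \<theta> - yP \<theta>"

text \<open>CDFs are functions on the whole real line; the underlying distributions are Borel
  measures on the real line that give full mass to \<open>Theta\<close>.\<close>

definition cdfs :: "(real \<Rightarrow> real) set" where
  "cdfs = {cdf N | N. real_distribution N \<and> measure N Theta = 1}"

definition mechanisms :: "real \<Rightarrow> real \<Rightarrow> (real \<Rightarrow> real measure) set" where
  "mechanisms \<alpha> \<beta> =
     measurable (restrict_space borel Theta) (prob_algebra (restrict_space borel {\<alpha>..\<beta>}))"

definition mech_mean :: "(real \<Rightarrow> real measure) \<Rightarrow> real \<Rightarrow> real" where
  "mech_mean m \<theta> = (\<integral>a. a \<partial>m \<theta>)"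

definition mech_var :: "(real \<Rightarrow> real measure) \<Rightarrow> real \<Rightarrow> real" where
  "mech_var m \<theta> = (\<integral>a. (a - mech_mean m \<theta>)\<^sup>2 \<partial>m \<theta>)"

text \<open>\<open>payoff y m \<theta> \<theta>'\<close>: true type \<open>\<theta>\<close>, reported type \<open>\<theta>'\<close>, ideal-action function \<open>y\<close>.\<close>

definition payoff ::
  "(real \<Rightarrow> real) \<Rightarrow> (real \<Rightarrow> real measure) \<Rightarrow> real \<Rightarrow> real \<Rightarrow> real" where
  "payoff y m \<theta> \<theta>' = - (\<integral>a. (a - y \<theta>)\<^sup>2 \<partial>m \<theta>')"

definition IC_mechanisms ::
  "real \<Rightarrow> real \<Rightarrow> (real \<Rightarrow> real) \<Rightarrow> (real \<Rightarrow> real measure) set" where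
  "IC_mechanisms \<alpha> \<beta> yA =
     {m \<in> mechanisms \<alpha> \<beta>. \<forall>\<theta>\<in>Theta. \<forall>\<theta>'\<in>Theta. payoff yA m \<theta> \<theta>' \<le> payoff yA m \<theta> \<theta>}"

text \<open>Integration against a CDF is integration against its Lebesgue-Stieltjes measure.\<close>

definition V :: "(real \<Rightarrow> real) \<Rightarrow> (real \<Rightarrow> real measure) \<Rightarrow> (real \<Rightarrow> real) \<Rightarrow> real" where
  "V yP m F = set_lebesgue_integral (interval_measure F) Theta (\<lambda>\<theta>. payoff yP m \<theta> \<theta>)"

text \<open>Payoffs are bounded, uniformly in the mechanism, since actions lie in a compact interval;
  so the real-valued infima and suprema below range over bounded sets.\<close>

definition worst_case :: "(real \<Rightarrow> real) \<Rightarrow> (real \<Rightarrow> real measure) \<Rightarrow> real" where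
  "worst_case yP m = (INF F\<in>cdfs. V yP m F)"

definition robust_value ::
  "real \<Rightarrow> real \<Rightarrow> (real \<Rightarrow> real) \<Rightarrow> (real \<Rightarrow> real) \<Rightarrow> real" where
  "robust_value \<alpha> \<beta> yP yA = (SUP m\<in>IC_mechanisms \<alpha> \<beta> yA. worst_case yP m)"

definition robustly_optimal ::
  "real \<Rightarrow> real \<Rightarrow> (real \<Rightarrow> real) \<Rightarrow> (real \<Rightarrow> real) \<Rightarrow> (real \<Rightarrow> real measure) \<Rightarrow> bool" where
  "robustly_optimal \<alpha> \<beta> yP yA m \<longleftrightarrow>
     m \<in> IC_mechanisms \<alpha> \<beta> yA \<and> worst_case yP m = robust_value \<alpha> \<beta> yP yA"

definition theta_bar :: "(real \<Rightarrow> real) \<Rightarrow> (real \<Rightarrow> real) \<Rightarrow> real" where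
  "theta_bar yP yA = the_inv_into Theta yA (yP 1)"

definition discount ::
  "(real \<Rightarrow> real) \<Rightarrow> (real \<Rightarrow> real) \<Rightarrow> (real \<Rightarrow> real) \<Rightarrow> real \<Rightarrow> real \<Rightarrow> real" where
  "discount yP yA y \<theta> x = exp (- integral {\<theta>..x} (\<lambda>t. dTheta y t / bias yP yA t))"

text \<open>Only the values at points with positive bias, and at 1 if the bias vanishes there, are
  meaningful. If the bias vanishes at 1, then \<open>theta_bar = 1\<close>, and both integrals with upper
  endpoint 1 are improper. Taking the one-sided limit of \<open>discount\<close> rather than of the integral in
  its exponent gives the value 0 when that integral diverges, which is the convention
  \<open>exp (-\<infinity>) = 0\<close>.\<close>

definition d_fun :: "(real \<Rightarrow> real) \<Rightarrow> (real \<Rightarrow> real) \<Rightarrow> real \<Rightarrow> real" where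
  "d_fun yP yA \<theta> =
     (if bias yP yA 1 = 0 then
        (if \<theta> = 1 then 0
         else bias yP yA 1 / 2 * Lim (at_left 1) (\<lambda>x. discount yP yA yP \<theta> x)
            + Lim (at_left 1) (\<lambda>x. integral {\<theta>..x} (\<lambda>t. dTheta yP t * discount yP yA yP \<theta> t)))
      else
        bias yP yA (theta_bar yP yA) / 2 * discount yP yA yP \<theta> (theta_bar yP yA)
        + integral {\<theta>..theta_bar yP yA} (\<lambda>t. dTheta yP t * discount yP yA yP \<theta> t))"

definition theta_low :: "(real \<Rightarrow> real) \<Rightarrow> (real \<Rightarrow> real) \<Rightarrow> real" where
  "theta_low yP yA =
     Inf {\<theta> \<in> {0..theta_bar yP yA}. bias yP yA \<theta> > 0 \<and> d_fun yP yA \<theta> \<le> bias yP yA \<theta>}"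

definition mu_star :: "(real \<Rightarrow> real) \<Rightarrow> (real \<Rightarrow> real) \<Rightarrow> real \<Rightarrow> real" where
  "mu_star yP yA \<theta> =
     (if \<theta> < theta_low yP yA then yA \<theta>
      else if \<theta> \<le> theta_bar yP yA then yP \<theta> + d_fun yP yA \<theta>
      else (yP (theta_bar yP yA) + yP 1) / 2)"

definition tau_star :: "(real \<Rightarrow> real) \<Rightarrow> (real \<Rightarrow> real) \<Rightarrow> real \<Rightarrow> real" where
  "tau_star yP yA \<theta> =
     (if \<theta> < theta_low yP yA then 0
      else if \<theta> \<le> theta_bar yP yA then (d_fun yP yA (theta_low yP yA))\<^sup>2 - (d_fun yP yA \<theta>)\<^sup>2
      else (d_fun yP yA (theta_low yP yA))\<^sup>2 - (bias yP yA (theta_bar yP yA))\<^sup>2 / 4)"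

text \<open>No improper integral is needed here: if \<open>theta_bar = 1\<close>, the integral below is only taken up
  to some \<open>\<theta> < 1\<close>.\<close>

definition F_star :: "(real \<Rightarrow> real) \<Rightarrow> (real \<Rightarrow> real) \<Rightarrow> real \<Rightarrow> real" where
  "F_star yP yA \<theta> =
     (if \<theta> < theta_low yP yA then 0
      else if \<theta> < 1 then
        1 - d_fun yP yA (theta_low yP yA) / bias yP yA (theta_low yP yA)
            * discount yP yA yA (theta_low yP yA) (min \<theta> (theta_bar yP yA))
      else 1)"

end

theory Submission
  imports Defs
begin

text \<open>The pair of the mechanism and \<open>F_star\<close> is a saddle point. Since \<open>d' = yP' (d - b) / b\<close>, the mean
  and the variance of the mechanism satisfy the local incentive constraint of the agent between
  \<open>theta_low\<close> and \<open>theta_bar\<close>, and the payoff of the principal is \<open>- d(theta_low)\<^sup>2\<close> there and at 1,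
  where \<open>F_star\<close> puts all its mass, and at least that elsewhere.

  Conversely, let \<open>m\<close> be any incentive compatible mechanism with mean \<open>\<mu>\<close> and agent's payoff \<open>U\<close>.
  By the envelope theorem \<open>U' = 2 yA' (\<mu> - yA)\<close> except at the countably many jumps of \<open>\<mu>\<close>, and the
  principal gets \<open>U - b (2 (\<mu> - yP) - b)\<close>. The survival function \<open>S\<close> of \<open>F_star\<close> solves
  \<open>S' = - (yA' / b) S\<close>, so that in the expected payoff the two integrals involving \<open>\<mu>\<close> cancel after
  integration by parts. What remains depends on the reports \<open>theta_low\<close>, \<open>theta_bar\<close> and 1 only, and
  completing the square at \<open>theta_low\<close> bounds it by \<open>- d(theta_low)\<^sup>2\<close>.\<close>

section \<open>Integration and exponential decay\<close>

text \<open>Serves the agent's payoff, which is differentiable only where the mean of the mechanism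
  is continuous. For the Henstock-Kurzweil integral, integrability of \<open>f'\<close> is part of
  the conclusion: the gauge controls the difference quotients at good tags, and continuity of
  \<open>f\<close> the increments at bad ones.\<close>

theorem fundamental_theorem_of_calculus_countable:
  fixes f f' :: "real \<Rightarrow> real"
  assumes "countable S" "a \<le> b" and cont: "continuous_on {a..b} f"
    and der: "\<And>x. x \<in> {a<..<b} - S \<Longrightarrow> (f has_real_derivative f' x) (at x)"
  shows "(f' has_integral (f b - f a)) {a..b}"
proof -
  \<comment> \<open>The endpoints count as exceptional because \<open>f\<close> is differentiated
    only inside the interval; they also make \<open>T\<close> nonempty, so that it can be
    enumerated.\<close>
  define T where "T = insert a (insert b S)"
  have T: "countable T" "T \<noteq> {}"
    using assms(1) by (auto simp: T_def)
  define c where "c = from_nat_into T"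
  have rangec: "range c = T"
    using T by (simp add: c_def range_from_nat_into)
  define g where "g x = (if x \<in> T then 0 else f' x)" for x
  text \<open>The weight \<open>\<omega>\<close> jumps by at least \<open>(1/2) ^ n\<close> at \<open>c n\<close>, so over intervals tagged by the
    exceptional point \<open>c n\<close> the increment of \<open>f\<close> is at most \<open>e\<close> times that of \<open>\<omega>\<close>, and the increments of
    \<open>\<omega>\<close> telescope.\<close>
  define w where "w x n = (1/2::real) ^ n * ((if c n < x then 1 else 0) + (if c n \<le> x then 1 else 0))"
    for x n
  define \<omega> where "\<omega> x = (\<Sum>n. w x n)" for x
  have w0: "0 \<le> w x n" "w x n \<le> 2 * (1/2) ^ n" for x n
    by (auto simp: w_def)
  have sumw: "summable (w x)" for x
    by (rule summable_comparison_test[where g = "\<lambda>n. 2 * (1/2) ^ n"])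
       (use w0 in \<open>auto intro!: summable_mult\<close>)
  have \<omega>0: "0 \<le> \<omega> x" for x
    unfolding \<omega>_def by (intro suminf_nonneg sumw w0)
  have \<omega>4: "\<omega> x \<le> 4" for x
  proof -
    have "\<omega> x \<le> (\<Sum>n. 2 * (1/2::real) ^ n)"
      unfolding \<omega>_def by (intro suminf_le sumw w0 summable_mult) simp
    also have "\<dots> = 4"
      by (subst suminf_mult) (auto simp: suminf_geometric)
    finally show ?thesis .
  qed
  have wmono: "w u n \<le> w v n" if "u \<le> v" for u v n
    using that by (auto simp: w_def)
  have \<omega>mono: "\<omega> u \<le> \<omega> v" if "u \<le> v" for u v
    unfolding \<omega>_def by (intro suminf_le sumw wmono that)
  \<comment> \<open>The strict and the weak indicator in \<open>w\<close> are both there because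
    \<open>c n\<close> may be either endpoint of the interval: in each position one of them still
    changes.\<close>
  have \<omega>jump: "(1/2) ^ n \<le> \<omega> v - \<omega> u" if "u < v" "u \<le> c n" "c n \<le> v" for u v n
  proof -
    have "(1/2) ^ n \<le> w v n - w u n"
      using that by (auto simp: w_def)
    also have "\<dots> \<le> (\<Sum>n. w v n - w u n)"
      using sum_le_suminf[of "\<lambda>n. w v n - w u n" "{n}"] wmono that(1)
      by (auto intro!: summable_diff sumw)
    also have "\<dots> = \<omega> v - \<omega> u"
      unfolding \<omega>_def by (intro suminf_diff[symmetric] sumw)
    finally show ?thesis .
  qed
  have "(g has_integral (f b - f a)) {a..b}"
    unfolding has_integral_real
  proof (intro allI impI)
    fix e0 :: real
    assume "e0 > 0"
    \<comment> \<open>4 bounds the total increase of \<open>\<omega>\<close>, so the errors add up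
      to at most \<open>e0 / 2\<close>, strictly below \<open>e0\<close>.\<close>
    define e where "e = e0 / 2 / (b - a + 4)"
    have e: "e > 0"
      using \<open>e0 > 0\<close> assms(2) by (auto simp: e_def)
    have "\<exists>d>0. \<forall>u v. u \<le> x \<and> x \<le> v \<and> a \<le> u \<and> v \<le> b \<and> \<bar>u - x\<bar> < d \<and> \<bar>v - x\<bar> < d \<longrightarrow>
        \<bar>(v - u) * g x - (f v - f u)\<bar> \<le> e * (v - u) + e * (\<omega> v - \<omega> u)" if x: "x \<in> {a..b}" for x
    proof (cases "x \<in> T")
      case True
      then obtain n where n: "x = c n"
        using rangec by auto
      have "e * (1/2) ^ n / 2 > 0"
        using e by simp
      then obtain d where d: "d > 0"
        "\<And>y. y \<in> {a..b} \<Longrightarrow> dist y x < d \<Longrightarrow> dist (f y) (f x) < e * (1/2) ^ n / 2"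
        using cont x unfolding continuous_on_iff by meson
      show ?thesis
      proof (intro exI[of _ d] conjI allI impI \<open>d > 0\<close>)
        fix u v
        assume A: "u \<le> x \<and> x \<le> v \<and> a \<le> u \<and> v \<le> b \<and> \<bar>u - x\<bar> < d \<and> \<bar>v - x\<bar> < d"
        show "\<bar>(v - u) * g x - (f v - f u)\<bar> \<le> e * (v - u) + e * (\<omega> v - \<omega> u)"
        proof (cases "u = v")
          case False
          then have uv: "u < v"
            using A by simp
          have "\<bar>f v - f x\<bar> < e * (1/2) ^ n / 2" "\<bar>f u - f x\<bar> < e * (1/2) ^ n / 2"
            using d(2)[of v] d(2)[of u] A by (auto simp: dist_real_def)
          then have "\<bar>f v - f u\<bar> \<le> e * (1/2) ^ n"
            by linarith
          also have "\<dots> \<le> e * (\<omega> v - \<omega> u)"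
            using \<omega>jump[of u v n] A n uv e by simp
          also have "\<dots> \<le> e * (v - u) + e * (\<omega> v - \<omega> u)"
            using e uv by simp
          finally show ?thesis
            using True by (simp add: g_def)
        qed simp
      qed
    next
      case False
      then have "(f has_real_derivative g x) (at x)"
        using der[of x] x by (auto simp: T_def g_def)
      then obtain d where d: "d > 0"
        "\<And>y. \<bar>y - x\<bar> < d \<Longrightarrow> \<bar>f y - f x - (y - x) * g x\<bar> \<le> e * \<bar>y - x\<bar>"
        using e unfolding has_field_derivative_def has_derivative_at_alt
        by (fastforce simp: mult.commute)
      show ?thesis
      proof (intro exI[of _ d] conjI allI impI \<open>d > 0\<close>)
        fix u v
        assume A: "u \<le> x \<and> x \<le> v \<and> a \<le> u \<and> v \<le> b \<and> \<bar>u - x\<bar> < d \<and> \<bar>v - x\<bar> < d"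
        have "\<bar>f v - f x - (v - x) * g x\<bar> \<le> e * (v - x)" "\<bar>f u - f x - (u - x) * g x\<bar> \<le> e * (x - u)"
          using d(2)[of v] d(2)[of u] A by auto
        then have "\<bar>(v - u) * g x - (f v - f u)\<bar> \<le> e * (v - u)"
          by (simp add: algebra_simps abs_le_iff)
        moreover have "0 \<le> e * (\<omega> v - \<omega> u)"
          using \<omega>mono[of u v] A e by simp
        ultimately show "\<bar>(v - u) * g x - (f v - f u)\<bar> \<le> e * (v - u) + e * (\<omega> v - \<omega> u)"
          by linarith
      qed
    qed
    then obtain d0 where d0: "\<And>x. x \<in> {a..b} \<Longrightarrow> d0 x > 0"
      "\<And>x u v. x \<in> {a..b} \<Longrightarrow> u \<le> x \<Longrightarrow> x \<le> v \<Longrightarrow> a \<le> u \<Longrightarrow> v \<le> b \<Longrightarrow> \<bar>u - x\<bar> < d0 x \<Longrightarrow>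
         \<bar>v - x\<bar> < d0 x \<Longrightarrow> \<bar>(v - u) * g x - (f v - f u)\<bar> \<le> e * (v - u) + e * (\<omega> v - \<omega> u)"
      by metis
    define d where "d x = (if x \<in> {a..b} then d0 x else 1)" for x
    have gauge: "gauge (\<lambda>x. ball x (d x))"
      by (rule gauge_ball_dependent) (use d0 in \<open>auto simp: d_def\<close>)
    have main: "norm ((\<Sum>(x, K)\<in>p. measure lborel K *\<^sub>R g x) - (f b - f a)) < e0"
      if ptag: "p tagged_division_of {a..b}" and fine: "(\<lambda>x. ball x (d x)) fine p" for p
    proof -
      have tele: "(\<Sum>(x, K)\<in>p. F (Sup K) - F (Inf K)) = F b - F a" for F :: "real \<Rightarrow> real"
        using additive_tagged_division_1[OF \<open>a \<le> b\<close> ptag, of F] .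
      have "norm (\<Sum>(x, K)\<in>p. measure lborel K *\<^sub>R g x - (f (Sup K) - f (Inf K)))
            \<le> (\<Sum>(x, K)\<in>p. e * (Sup K - Inf K) + e * (\<omega> (Sup K) - \<omega> (Inf K)))"
      proof (rule sum_norm_le, safe)
        fix x K
        assume xK: "(x, K) \<in> p"
        then obtain u v where K: "K = cbox u v" and x: "x \<in> K" and Kab: "K \<subseteq> {a..b}"
          using ptag by (metis tagged_division_ofD(2-4))
        have uv: "u \<le> x" "x \<le> v" "a \<le> u" "v \<le> b" "x \<in> {a..b}"
          using x Kab unfolding K by (auto simp: subset_iff)
        have "K \<subseteq> ball x (d x)"
          using fine xK by (rule fineD)
        moreover have "u \<in> K" "v \<in> K"
          using uv by (auto simp: K)
        ultimately have "u \<in> ball x (d x)" "v \<in> ball x (d x)"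
          by blast+
        then have "\<bar>u - x\<bar> < d0 x" "\<bar>v - x\<bar> < d0 x"
          using uv by (auto simp: d_def dist_real_def)
        with d0(2)[of x u v] uv
        show "norm (measure lborel K *\<^sub>R g x - (f (Sup K) - f (Inf K)))
            \<le> e * (Sup K - Inf K) + e * (\<omega> (Sup K) - \<omega> (Inf K))"
          by (simp add: K)
      qed
      also have "\<dots> = e * (b - a) + e * (\<omega> b - \<omega> a)"
        using tele[of "\<lambda>x. e * x + e * \<omega> x"] by (simp add: algebra_simps split_def)
      also have "\<dots> = e * (b - a + (\<omega> b - \<omega> a))"
        by (simp add: algebra_simps)
      also have "\<dots> \<le> e * (b - a + 4)"
        using e \<omega>4[of b] \<omega>0[of a] by (intro mult_left_mono) auto
      also have "\<dots> = e0 / 2"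
        unfolding e_def by (rule nonzero_eq_divide_eq[THEN iffD1]) (use assms(2) in auto)
      also have "\<dots> < e0"
        using \<open>e0 > 0\<close> by simp
      finally show ?thesis
        using tele[of f] by (simp add: split_def sum_subtractf)
    qed
    show "\<exists>\<gamma>. gauge \<gamma> \<and> (\<forall>\<D>. \<D> tagged_division_of {a..b} \<and> \<gamma> fine \<D> \<longrightarrow>
        norm ((\<Sum>(x, K)\<in>\<D>. measure lborel K *\<^sub>R g x) - (f b - f a)) < e0)"
      by (rule exI[of _ "\<lambda>x. ball x (d x)"], rule conjI[OF gauge]) (intro allI impI main; elim conjE)
  qed
  moreover have "negligible T"
    using negligible_countable_Union[of "(\<lambda>x. {x}) ` T"] T(1) by auto
  ultimately show ?thesis
    using has_integral_spike[of T "{a..b}" f' g] by (simp add: g_def)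
qed

lemma C1_has_real_derivative:
  assumes "C1_on_Theta y" "0 < t" "t < 1"
  shows "(y has_real_derivative dTheta y t) (at t)"
proof -
  have "y differentiable (at t within Theta)"
    using assms by (auto simp: C1_on_Theta_def differentiable_on_def)
  then have "(y has_vector_derivative dTheta y t) (at t within Theta)"
    unfolding dTheta_def by (simp add: vector_derivative_works)
  then show ?thesis
    using assms by (simp add: at_within_Icc_at has_real_derivative_iff_has_vector_derivative)
qed

lemma dTheta_nonneg:
  assumes "C1_on_Theta y" "strict_mono_on Theta y" "0 < t" "t < 1"
  shows "0 \<le> dTheta y t"
  using mono_on_imp_deriv_nonneg[OF strict_mono_on_imp_mono_on[OF assms(2)] C1_has_real_derivative]
    assms by simp

section \<open>Exponential decay up to a possibly singular endpoint\<close>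

text \<open>The value at \<open>h\<close> is a left limit because \<open>q\<close> may blow up
  there. If its integral diverges to infinity, the limit is 0, whereas \<open>integral\<close> would
  take its default value 0 and the exponential would be 1.\<close>

definition decay :: "(real \<Rightarrow> real) \<Rightarrow> real \<Rightarrow> real \<Rightarrow> real \<Rightarrow> real" where
  "decay q c h x =
     (if x < h then exp (- integral {c..x} q) else Lim (at_left h) (\<lambda>x. exp (- integral {c..x} q)))"

text \<open>As \<open>q\<close> is nonnegative, the exponential is antitone and bounded below by 0,
  so it converges to its infimum at \<open>h\<close>. This makes \<open>decay\<close> continuous on
  the closed interval, whether or not \<open>q\<close> is integrable up to \<open>h\<close>.\<close>

lemma
  assumes "c < h" and q: "continuous_on {c..<h} q" and nonneg: "\<And>t. c < t \<Longrightarrow> t < h \<Longrightarrow> 0 \<le> q t"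
  shows decay_deriv: "\<And>t. c < t \<Longrightarrow> t < h \<Longrightarrow> (decay q c h has_real_derivative - q t * decay q c h t) (at t)"
    and continuous_on_decay: "continuous_on {c..h} (decay q c h)"
    and decay_end_nonneg: "0 \<le> decay q c h h"
proof -
  let ?r = "\<lambda>x. exp (- integral {c..x} q)"
  have sub: "continuous_on {c..x} q" if "x < h" for x
    by (rule continuous_on_subset[OF q]) (use that in auto)
  have deriv0: "(?r has_real_derivative - q t * ?r t) (at t)" if "c < t" "t < h" for t
  proof -
    obtain u where u: "t < u" "u < h"
      using dense \<open>t < h\<close> by blast
    have "((\<lambda>x. integral {c..x} q) has_real_derivative q t) (at t within {c..u})"
      by (rule integral_has_real_derivative[OF sub]) (use u that in auto)
    then have "((\<lambda>x. integral {c..x} q) has_real_derivative q t) (at t)"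
      using u that by (simp add: at_within_Icc_at)
    then show ?thesis
      by (auto intro!: derivative_eq_intros)
  qed
  have cont0: "continuous_on {c..<h} ?r"
  proof -
    have "continuous (at t within {c..<h}) (\<lambda>x. integral {c..x} q)" if "t \<in> {c..<h}" for t
    proof -
      obtain u where u: "t < u" "u < h"
        using dense[of t h] \<open>t \<in> {c..<h}\<close> by auto
      have "continuous_on {c..u} (\<lambda>x. integral {c..x} q)"
        by (intro indefinite_integral_continuous_1 integrable_continuous_interval sub u)
      then have "continuous (at t within {c..u}) (\<lambda>x. integral {c..x} q)"
        using u that by (auto simp: continuous_on_eq_continuous_within)
      moreover have "at t within {c..u} = at t within {c..<h}"
        by (rule at_within_nhd[of _ "{..<u}"]) (use u that in auto)
      ultimately show ?thesis
        by simp
    qed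
    then have "continuous_on {c..<h} (\<lambda>x. integral {c..x} q)"
      by (simp add: continuous_on_eq_continuous_within)
    then show ?thesis
      by (intro continuous_intros)
  qed
  have anti: "?r y \<le> ?r x" if "c \<le> x" "x \<le> y" "y < h" for x y
  proof (rule DERIV_nonpos_imp_decreasing_open[OF \<open>x \<le> y\<close>])
    show "\<exists>z. (?r has_real_derivative z) (at t) \<and> z \<le> 0" if "x < t" "t < y" for t
      using deriv0[of t] nonneg[of t] that \<open>c \<le> x\<close> \<open>y < h\<close> by (intro exI conjI) auto
    show "continuous_on {x..y} ?r"
      by (rule continuous_on_subset[OF cont0]) (use that in auto)
  qed
  let ?L = "Inf (?r ` {c..<h})"
  have bdd: "bdd_below (?r ` {c..<h})"
    by (rule bdd_belowI[of _ 0]) auto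
  have lim: "(?r \<longlongrightarrow> ?L) (at_left h)"
  proof (rule decreasing_tendsto)
    have "?L \<le> ?r x" if "c < x" "x < h" for x
      by (rule cINF_lower[OF bdd]) (use that in auto)
    then show "\<forall>\<^sub>F x in at_left h. ?L \<le> ?r x"
      using eventually_at_left_real[OF \<open>c < h\<close>] by (auto elim: eventually_mono)
    fix z assume "?L < z"
    then obtain x where x: "x \<in> {c..<h}" "?r x < z"
      using bdd \<open>c < h\<close> by (subst (asm) cINF_less_iff) auto
    have "\<forall>\<^sub>F y in at_left h. y \<in> {x<..<h}"
      by (rule eventually_at_left_real) (use x in auto)
    then show "\<forall>\<^sub>F y in at_left h. ?r y < z"
    proof eventually_elim
      case (elim y)
      then have "?r y \<le> ?r x"
        using anti[of x y] x by auto
      then show ?case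
        using x(2) by (rule le_less_trans)
    qed
  qed
  have hend: "decay q c h h = ?L"
    using tendsto_Lim[OF _ lim] by (simp add: decay_def)
  then show "0 \<le> decay q c h h"
    using \<open>c < h\<close> by (auto intro!: cINF_greatest)
  have eq: "\<forall>\<^sub>F x in nhds t. ?r x = decay q c h x" if "t < h" for t
    using eventually_nhds_in_open[of "{..<h}" t] that by (auto simp: decay_def elim: eventually_mono)
  show "(decay q c h has_real_derivative - q t * decay q c h t) (at t)" if "c < t" "t < h" for t
    using DERIV_cong_ev[OF refl eq refl, of t] deriv0[of t] that
    by (simp add: decay_def[where x = t])
  show "continuous_on {c..h} (decay q c h)"
    unfolding continuous_on_def
  proof
    fix t assume t: "t \<in> {c..h}"
    have "\<forall>\<^sub>F x in at_left h. ?r x = decay q c h x"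
      by (simp add: eventually_at_filter decay_def)
    then have hlim: "(decay q c h \<longlongrightarrow> decay q c h h) (at_left h)"
      using lim hend by (auto simp: tendsto_cong)
    show "(decay q c h \<longlongrightarrow> decay q c h t) (at t within {c..h})"
    proof (cases "t = h")
      case True
      have "at h within {c..h} \<le> at_left h"
        using \<open>c < h\<close> by (simp add: at_within_Icc_at_left)
      with True show ?thesis
        using hlim tendsto_mono by blast
    next
      case False
      then have "t < h"
        using t by simp
      have "at t within {c..h} = at t within {c..<h}"
        by (rule at_within_nhd[of _ "{..<h}"]) (use \<open>t < h\<close> in auto)
      moreover have "(?r \<longlongrightarrow> ?r t) (at t within {c..<h})"
        using cont0 t \<open>t < h\<close> by (auto simp: continuous_on_def)
      moreover have "\<forall>\<^sub>F x in at t within {c..<h}. ?r x = decay q c h x"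
        by (simp add: eventually_at_filter decay_def)
      ultimately show ?thesis
        using \<open>t < h\<close> tendsto_cong[of ?r "decay q c h"] by (simp add: decay_def[where x = t])
    qed
  qed
qed

lemma decay_pos: "x < h \<Longrightarrow> 0 < decay q c h x"
  by (simp add: decay_def)

lemma decay_start: "c < h \<Longrightarrow> decay q c h c = 1"
  by (simp add: decay_def)

lemma decay_end:
  assumes "c < h" and q: "continuous_on {c..h} q"
  shows "decay q c h h = exp (- integral {c..h} q)"
proof -
  have "continuous_on {c..h} (\<lambda>x. exp (- integral {c..x} q))"
    by (intro continuous_intros indefinite_integral_continuous_1 integrable_continuous_interval q)
  then have "((\<lambda>x. exp (- integral {c..x} q)) \<longlongrightarrow> exp (- integral {c..h} q)) (at_left h)"
    using \<open>c < h\<close> by (auto simp: continuous_on_def at_within_Icc_at_left dest!: bspec[where x = h])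
  then show ?thesis
    using tendsto_Lim[OF trivial_limit_at_left_real] by (simp add: decay_def)
qed

section \<open>Distributions with a density and two atoms\<close>

text \<open>The integral of \<open>f x * u x\<close> is taken in Henstock-Kurzweil form, so that the
  fundamental theorem can supply it even if \<open>f\<close> is unbounded near \<open>h\<close>;
  nonnegativity turns it into a Lebesgue integral.\<close>

lemma atom_density_mixture:
  fixes f :: "real \<Rightarrow> real" and l h r k M :: real
  assumes "l < h" "h \<le> r" "0 \<le> k" "0 \<le> M"
    and f0: "\<And>x. l < x \<Longrightarrow> x < h \<Longrightarrow> 0 \<le> f x"
    and fm: "(\<lambda>x. indicator {l<..<h} x * f x) \<in> borel_measurable borel"
    and fint: "(f has_integral (1 - k - M)) {l..h}"
  obtains N where "real_distribution N"
    "\<And>u I. u \<in> borel_measurable borel \<Longrightarrow> (\<And>x. 0 \<le> u x) \<Longrightarrow>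
       ((\<lambda>x. f x * u x) has_integral I) {l..h} \<Longrightarrow>
       (\<integral>\<^sup>+x. ennreal (u x) \<partial>N) = ennreal (k * u l + I + M * u r)"
proof
  text \<open>\<open>N\<close> is the image under \<open>\<phi>\<close> of a measure with a density, in which the atoms at \<open>l\<close> and \<open>r\<close> are
    spread over \<open>{l-1<..<l}\<close> and \<open>{h<..<h+1}\<close>.\<close>
  define \<phi> where "\<phi> x = (if x \<le> l then l else if x < h then x else r)" for x
  define g where "g x = k * indicator {l-1<..<l} x + indicator {l<..<h} x * f x
      + M * indicator {h<..<h+1} x" for x
  define N where "N = distr (density lborel (\<lambda>x. ennreal (g x))) borel \<phi>"
  have [measurable]: "\<phi> \<in> borel_measurable borel"
    unfolding \<phi>_def by measurable
  have [measurable]: "g \<in> borel_measurable borel"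
    unfolding g_def using fm by measurable
  have int: "(\<integral>\<^sup>+x. ennreal (u x) \<partial>N) = ennreal (k * u l + I + M * u r)"
    if [measurable]: "u \<in> borel_measurable borel" and u0: "\<And>x. 0 \<le> u x"
      and I: "((\<lambda>x. f x * u x) has_integral I) {l..h}" for u I
  proof -
    have I': "((\<lambda>x. f x * u x) has_integral I) {l<..<h}"
      using I by (simp add: has_integral_Icc_iff_Ioo)
    have I0: "0 \<le> I"
      by (rule has_integral_nonneg[OF I']) (use f0 u0 in auto)
    have fu[measurable]: "(\<lambda>x. ennreal (f x * u x) * indicator {l<..<h} x) \<in> borel_measurable borel"
    proof -
      have "(\<lambda>x. ennreal ((indicator {l<..<h} x * f x) * u x)) \<in> borel_measurable borel"
        using fm by measurable
      also have "(\<lambda>x. ennreal ((indicator {l<..<h} x * f x) * u x))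
          = (\<lambda>x. ennreal (f x * u x) * indicator {l<..<h} x)"
        by (auto simp: indicator_def)
      finally show ?thesis .
    qed
    have "(\<integral>\<^sup>+x. ennreal (u x) \<partial>N) = (\<integral>\<^sup>+x. ennreal (g x) * ennreal (u (\<phi> x)) \<partial>lborel)"
      unfolding N_def by (simp add: nn_integral_distr nn_integral_density)
    also have "\<dots> = (\<integral>\<^sup>+x. ennreal (k * u l) * indicator {l-1<..<l} x
        + (ennreal (f x * u x) * indicator {l<..<h} x
        + ennreal (M * u r) * indicator {h<..<h+1} x) \<partial>lborel)"
    proof (rule nn_integral_cong)
      fix x
      show "ennreal (g x) * ennreal (u (\<phi> x)) = ennreal (k * u l) * indicator {l-1<..<l} x
        + (ennreal (f x * u x) * indicator {l<..<h} x
        + ennreal (M * u r) * indicator {h<..<h+1} x)"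
        using assms(1-4) f0[of x] u0
        by (auto simp: g_def \<phi>_def indicator_def ennreal_mult[symmetric])
    qed
    also have "\<dots> = ennreal (k * u l) + (ennreal I + ennreal (M * u r))"
      using nn_integral_has_integral_lebesgue'[OF _ I'] f0 u0
      by (simp add: nn_integral_add nn_integral_cmult_indicator)
    also have "\<dots> = ennreal (k * u l + I + M * u r)"
      using assms(3,4) u0 I0 by (simp add: ennreal_plus[symmetric] add.assoc del: ennreal_plus)
    finally show ?thesis .
  qed
  then show "\<And>u I. u \<in> borel_measurable borel \<Longrightarrow> (\<And>x. 0 \<le> u x) \<Longrightarrow>
       ((\<lambda>x. f x * u x) has_integral I) {l..h} \<Longrightarrow>
       (\<integral>\<^sup>+x. ennreal (u x) \<partial>N) = ennreal (k * u l + I + M * u r)" .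
  have "emeasure N (space N) = 1"
    using int[of "\<lambda>_. 1" "1 - k - M"] fint by simp
  then interpret prob_space N
    by (rule prob_spaceI)
  show "real_distribution N"
    by unfold_locales (simp_all add: N_def)
qed

section \<open>The differential equation for \<open>d\<close> and the cutoff\<close>

lemma has_real_derivative_eventually_eq:
  assumes "(f has_real_derivative D) (at x)" "\<forall>\<^sub>F s in nhds x. f s = g s"
  shows "(g has_real_derivative D) (at x)"
  using assms DERIV_cong_ev[OF refl assms(2) refl] by simp

section \<open>The sign of the bias and the position of \<open>theta_bar\<close>\<close>

locale biased_delegation =
  fixes yP yA :: "real \<Rightarrow> real"
  assumes C1P: "C1_on_Theta yP" and C1A: "C1_on_Theta yA"
    and smP: "strict_mono_on Theta yP" and smA: "strict_mono_on Theta yA"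
    and bias_mono: "mono_on Theta (bias yP yA) \<or> antimono_on Theta (bias yP yA)"
    and bias_zero: "\<exists>\<^sub>\<le>\<^sub>1 \<theta>. \<theta> \<in> Theta \<and> bias yP yA \<theta> = 0"
    and bias_nonneg: "\<And>\<theta>. \<theta> \<in> Theta \<Longrightarrow> bias yP yA \<theta> \<ge> 0"
    and overlap: "\<exists>u v. u < v \<and> {u..v} \<subseteq> yP ` Theta \<inter> yA ` Theta"
begin

abbreviation b where "b \<equiv> bias yP yA"
abbreviation hi where "hi \<equiv> theta_bar yP yA"
abbreviation lo where "lo \<equiv> theta_low yP yA"
abbreviation d where "d \<equiv> d_fun yP yA"

lemma yA_eq: "yA t = yP t + b t"
  by (simp add: bias_def)

lemma continuous_ideal: "continuous_on Theta yP" "continuous_on Theta yA"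
  using C1P C1A by (auto simp: C1_on_Theta_def differentiable_imp_continuous_on)

lemma continuous_bias: "continuous_on Theta b"
  unfolding bias_def by (intro continuous_intros continuous_ideal)

lemma continuous_bias_Icc: "0 \<le> u \<Longrightarrow> v \<le> 1 \<Longrightarrow> continuous_on {u..v} b"
  by (rule continuous_on_subset[OF continuous_bias]) auto

text \<open>A nonnegative monotone function with an interior zero also vanishes at one of the
  endpoints, which contradicts the uniqueness of the zero.\<close>

lemma bias_pos:
  assumes "0 < t" "t < 1"
  shows "0 < b t"
proof (rule ccontr)
  assume "\<not> 0 < b t"
  with bias_nonneg[of t] assms have "b t = 0"
    by simp
  moreover have "b 0 = 0 \<or> b 1 = 0"
    using bias_mono
  proof
    assume "mono_on Theta b"
    then have "b 0 \<le> b t"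
      using assms by (auto intro: mono_onD)
    with \<open>b t = 0\<close> bias_nonneg[of 0] show ?thesis
      by simp
  next
    assume "antimono_on Theta b"
    then have "b 1 \<le> b t"
      using assms by (auto intro: monotone_onD)
    with \<open>b t = 0\<close> bias_nonneg[of 1] show ?thesis
      by simp
  qed
  ultimately show False
    using Uniq_D[OF bias_zero, of t 0] Uniq_D[OF bias_zero, of t 1] assms by auto
qed

lemma yP_le: "0 \<le> s \<Longrightarrow> s \<le> t \<Longrightarrow> t \<le> 1 \<Longrightarrow> yP s \<le> yP t"
  using smP by (auto simp: strict_mono_on_leD)

lemma yA_le: "0 \<le> s \<Longrightarrow> s \<le> t \<Longrightarrow> t \<le> 1 \<Longrightarrow> yA s \<le> yA t"
  using smA by (auto simp: strict_mono_on_leD)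

lemma yA_less_iff: "s \<in> Theta \<Longrightarrow> t \<in> Theta \<Longrightarrow> yA s < yA t \<longleftrightarrow> s < t"
  using smA by (rule strict_mono_on_less)

lemma yA_0_less: "yA 0 < yP 1"
proof -
  obtain u v where uv: "u < v" "{u..v} \<subseteq> yP ` Theta \<inter> yA ` Theta"
    using overlap by blast
  then have "u \<in> {u..v}" "v \<in> {u..v}"
    by auto
  with uv(2) obtain s t where "s \<in> Theta" "u = yA s" "t \<in> Theta" "v = yP t"
    by blast
  with uv(1) yA_le[of 0 s] yP_le[of t 1] show ?thesis
    by auto
qed

lemma theta_bar_in: "hi \<in> Theta" and yA_theta_bar: "yA hi = yP 1"
proof -
  have "yP 1 \<le> yA 1"
    using bias_nonneg[of 1] by (simp add: bias_def)
  then obtain x where "x \<in> Theta" "yA x = yP 1"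
    using IVT'[of yA 0 "yP 1" 1] yA_0_less continuous_ideal by auto
  then have "yP 1 \<in> yA ` Theta"
    by (metis image_eqI)
  moreover have "inj_on yA Theta"
    using smA by (rule strict_mono_on_imp_inj_on)
  ultimately show "hi \<in> Theta" "yA hi = yP 1"
    unfolding theta_bar_def
    using the_inv_into_into[of yA Theta "yP 1" Theta] f_the_inv_into_f[of yA Theta "yP 1"] by auto
qed

lemma hi_pos: "0 < hi" and hi_le_1: "hi \<le> 1"
  using yA_0_less yA_less_iff[of 0 hi] theta_bar_in yA_theta_bar by auto

lemma hi_less_1: "b 1 \<noteq> 0 \<Longrightarrow> hi < 1"
  using yA_less_iff[of hi 1] theta_bar_in yA_theta_bar bias_nonneg[of 1] by (auto simp: bias_def)

lemma hi_eq_1: "b 1 = 0 \<Longrightarrow> hi = 1"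
  using yA_less_iff[of hi 1] theta_bar_in yA_theta_bar by (auto simp: bias_def)

lemma bias_pos_hi: "b 1 \<noteq> 0 \<Longrightarrow> 0 < b hi"
  using bias_pos hi_pos hi_less_1 by simp

lemma bias_nonneg_hi: "0 \<le> b hi"
  using bias_nonneg theta_bar_in by simp

text \<open>Left endpoints \<open>c\<close> with positive bias cover 0 and interior points at once;
  to the right of \<open>c\<close> the bias can vanish only at 1.\<close>

lemma bias_pos_from:
  assumes "0 \<le> c" "0 < b c" "c \<le> t" "t < hi"
  shows "0 < b t"
  using assms bias_pos[of t] hi_le_1 by (cases "t = c") auto

lemma continuous_dTheta: "C1_on_Theta y \<Longrightarrow> 0 \<le> u \<Longrightarrow> v \<le> 1 \<Longrightarrow> continuous_on {u..v} (dTheta y)"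
  unfolding C1_on_Theta_def by (auto intro: continuous_on_subset)

lemma continuous_rate:
  assumes "C1_on_Theta y" "0 \<le> c" "0 < b c"
  shows "continuous_on {c..<hi} (\<lambda>t. dTheta y t / b t)"
proof (intro continuous_intros)
  show "continuous_on {c..<hi} (dTheta y)"
    by (rule continuous_on_subset[OF continuous_dTheta[OF assms(1), of 0 1]])
       (use assms hi_le_1 in auto)
  show "continuous_on {c..<hi} b"
    by (rule continuous_on_subset[OF continuous_bias]) (use assms hi_le_1 in auto)
  show "\<forall>t\<in>{c..<hi}. b t \<noteq> 0"
    using bias_pos_from[OF assms(2,3)] by fastforce
qed

lemma continuous_rate_closed:
  assumes "C1_on_Theta y" "0 \<le> c" "0 < b c" "b 1 \<noteq> 0"
  shows "continuous_on {c..hi} (\<lambda>t. dTheta y t / b t)"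
proof (intro continuous_intros continuous_dTheta continuous_bias_Icc assms hi_le_1)
  show "\<forall>t\<in>{c..hi}. b t \<noteq> 0"
  proof
    fix t assume "t \<in> {c..hi}"
    then show "b t \<noteq> 0"
      using bias_pos_from[OF assms(2,3), of t] bias_pos_hi[OF assms(4)] by (cases "t = hi") auto
  qed
qed

text \<open>Solution of \<open>e' = - (y' / b) e\<close> that starts with 1 at \<open>c\<close>. For
  \<open>yP\<close> it is the integrating factor of the equation for \<open>d\<close>; for
  \<open>yA\<close> and \<open>c = lo\<close> it is, up to a constant factor, the survival function
  of \<open>F_star\<close> between \<open>lo\<close> and \<open>hi\<close>.\<close>

abbreviation surv where "surv y c \<equiv> decay (\<lambda>t. dTheta y t / b t) c hi"

context
  fixes y c
  assumes y: "C1_on_Theta y" "strict_mono_on Theta y" and c: "0 \<le> c" "c < hi" "0 < b c"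
begin

lemma rate_nonneg: "c < t \<Longrightarrow> t < hi \<Longrightarrow> 0 \<le> dTheta y t / b t"
  using dTheta_nonneg[OF y, of t] bias_pos_from[of c t] c hi_le_1 by simp

lemma surv_deriv:
  "c < t \<Longrightarrow> t < hi \<Longrightarrow> (surv y c has_real_derivative - (dTheta y t / b t) * surv y c t) (at t)"
  using rate_nonneg by (rule decay_deriv[OF c(2) continuous_rate[OF y(1) c(1,3)]])

lemma continuous_surv: "continuous_on {c..hi} (surv y c)"
  using rate_nonneg by (rule continuous_on_decay[OF c(2) continuous_rate[OF y(1) c(1,3)]])

lemma surv_end_nonneg: "0 \<le> surv y c hi"
  using rate_nonneg by (rule decay_end_nonneg[OF c(2) continuous_rate[OF y(1) c(1,3)]])

lemma surv_nonneg: "t \<le> hi \<Longrightarrow> 0 \<le> surv y c t"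
  using surv_end_nonneg decay_pos[of t hi] by (cases "t = hi") (auto intro: less_imp_le)

lemma discount_eq:
  assumes "c \<le> t" "t \<le> x" "t < hi" "x < hi \<or> x = hi \<and> b 1 \<noteq> 0"
  shows "discount yP yA y t x = surv y c x / surv y c t"
proof -
  let ?q = "\<lambda>t. dTheta y t / b t"
  have "continuous_on {c..x} ?q"
    using assms(4)
  proof
    assume "x < hi"
    then show ?thesis
      by (auto intro: continuous_on_subset[OF continuous_rate[OF y(1) c(1,3)]])
  next
    assume "x = hi \<and> b 1 \<noteq> 0"
    then show ?thesis
      using continuous_rate_closed[OF y(1) c(1,3)] by simp
  qed
  then have "integral {c..t} ?q + integral {t..x} ?q = integral {c..x} ?q"
    using assms by (intro Henstock_Kurzweil_Integration.integral_combine integrable_continuous_interval)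
  moreover have "surv y c x = exp (- integral {c..x} ?q)"
    using assms(4)
  proof
    assume "x < hi"
    then show ?thesis
      by (simp add: decay_def)
  next
    assume "x = hi \<and> b 1 \<noteq> 0"
    then show ?thesis
      using decay_end[OF c(2) continuous_rate_closed[OF y(1) c(1,3)]] by simp
  qed
  ultimately show ?thesis
    using assms by (simp add: discount_def decay_def[where x = t] exp_diff[symmetric])
qed

end

lemma d_hi: "d hi = b hi / 2"
proof (cases "b 1 = 0")
  case True
  then show ?thesis
    using hi_eq_1 by (simp add: d_fun_def)
next
  case False
  then show ?thesis
    by (simp add: d_fun_def discount_def)
qed

section \<open>The integral formula and the differential equation for \<open>d\<close>\<close>

context
  fixes c
  assumes c: "0 \<le> c" "c < hi" "0 < b c"
begin

lemma continuous_integrand: "c \<le> t \<Longrightarrow> continuous_on {t..hi} (\<lambda>s. dTheta yP s * surv yP c s)"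
  using c hi_le_1
  by (intro continuous_intros continuous_dTheta C1P
      continuous_on_subset[OF continuous_surv[OF C1P smP c]]) auto

text \<open>Multiplication by the integrating factor takes \<open>t\<close> out of the integrand and
  leaves one formula for both cases of the definition of \<open>d\<close>, from which continuity and
  the derivative can be read off.\<close>

lemma d_surv:
  assumes t: "c \<le> t" "t \<le> hi"
  shows "d t * surv yP c t
    = surv yP c hi * b hi / 2 + integral {t..hi} (\<lambda>s. dTheta yP s * surv yP c s)"
proof (cases "t = hi")
  case True
  then show ?thesis
    by (simp add: d_hi)
next
  case False
  then have t: "c \<le> t" "t < hi"
    using t by auto
  let ?e = "surv yP c"
  have pos: "0 < ?e t"
    using t by (simp add: decay_pos)
  note disc = discount_eq[OF C1P smP c t(1)]
  show ?thesis
  proof (cases "b 1 = 0")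
    case False
    have "integral {t..hi} (\<lambda>s. dTheta yP s * discount yP yA yP t s)
        = integral {t..hi} (\<lambda>s. dTheta yP s * ?e s / ?e t)"
      by (rule integral_cong) (use False t disc in \<open>auto simp: less_le\<close>)
    then show ?thesis
      using False t pos disc[of hi] by (simp add: d_fun_def field_simps)
  next
    case True
    then have hi: "hi = 1"
      by (rule hi_eq_1)
    \<comment> \<open>The first summand of \<open>d\<close> vanishes with the bias at 1. In terms of
      \<open>surv\<close>, which is continuous up to \<open>hi\<close>, the improper integral
      becomes an ordinary one.\<close>
    let ?I = "\<lambda>x. integral {t..x} (\<lambda>s. dTheta yP s * ?e s)"
    have "continuous_on {t..hi} ?I"
      by (intro indefinite_integral_continuous_1 integrable_continuous_interval
          continuous_integrand t)
    then have "(?I \<longlongrightarrow> ?I hi) (at_left hi)"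
      using t by (auto simp: continuous_on_def at_within_Icc_at_left dest!: bspec[where x = hi])
    then have lim: "((\<lambda>x. ?I x / ?e t) \<longlongrightarrow> ?I hi / ?e t) (at_left hi)"
      using pos by (intro tendsto_intros) auto
    have "\<forall>\<^sub>F x in at_left hi. x \<in> {t<..<hi}"
      using t by (intro eventually_at_left_real)
    then have "\<forall>\<^sub>F x in at_left hi.
        ?I x / ?e t = integral {t..x} (\<lambda>s. dTheta yP s * discount yP yA yP t s)"
    proof eventually_elim
      case (elim x)
      have "integral {t..x} (\<lambda>s. dTheta yP s * discount yP yA yP t s)
          = integral {t..x} (\<lambda>s. dTheta yP s * ?e s / ?e t)"
        by (rule integral_cong) (use elim t disc in auto)
      then show ?case
        by simp
    qed
    with lim have "((\<lambda>x. integral {t..x} (\<lambda>s. dTheta yP s * discount yP yA yP t s))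
        \<longlongrightarrow> ?I hi / ?e t) (at_left hi)"
      by (simp add: tendsto_cong)
    then have "d t = ?I hi / ?e t"
      using True t hi tendsto_Lim[OF trivial_limit_at_left_real] by (simp add: d_fun_def)
    then show ?thesis
      using True hi pos by simp
  qed
qed

lemma continuous_d_surv: "continuous_on {c..hi} (\<lambda>t. d t * surv yP c t)"
proof -
  have "continuous_on {c..hi} (\<lambda>t. integral {t..hi} (\<lambda>s. dTheta yP s * surv yP c s))"
    by (rule DERIV_continuous_on[OF integral_has_real_derivative'[OF continuous_integrand]]) auto
  then have "continuous_on {c..hi} (\<lambda>t. surv yP c hi * b hi / 2
      + integral {t..hi} (\<lambda>s. dTheta yP s * surv yP c s))"
    by (intro continuous_intros)
  then show ?thesis
    by (rule continuous_on_eq) (simp only: d_surv atLeastAtMost_iff)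
qed

lemma d_surv_deriv:
  assumes "c < t" "t < hi"
  shows "((\<lambda>t. d t * surv yP c t) has_real_derivative - dTheta yP t * surv yP c t) (at t)"
proof -
  have "((\<lambda>t. integral {t..hi} (\<lambda>s. dTheta yP s * surv yP c s))
      has_real_derivative - (dTheta yP t * surv yP c t)) (at t within {c..hi})"
    by (rule integral_has_real_derivative'[OF continuous_integrand]) (use assms in auto)
  then have "((\<lambda>t. surv yP c hi * b hi / 2 + integral {t..hi} (\<lambda>s. dTheta yP s * surv yP c s))
      has_real_derivative - dTheta yP t * surv yP c t) (at t)"
    using assms by (auto simp: at_within_Icc_at intro!: derivative_eq_intros)
  moreover have "\<forall>\<^sub>F s in nhds t. surv yP c hi * b hi / 2
      + integral {s..hi} (\<lambda>s. dTheta yP s * surv yP c s) = d s * surv yP c s"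
    using eventually_nhds_in_open[of "{c<..<hi}" t] assms
    by (auto simp: d_surv elim!: eventually_mono)
  ultimately show ?thesis
    by (rule has_real_derivative_eventually_eq)
qed

text \<open>The product of \<open>d\<close> and \<open>surv\<close> decreases to a nonnegative value
  at \<open>hi\<close>, as its derivative is \<open>- yP' surv\<close>. The point \<open>hi\<close>
  is treated apart because \<open>surv\<close> may vanish there.\<close>

lemma d_nonneg:
  assumes "c \<le> t" "t \<le> hi"
  shows "0 \<le> d t"
proof (cases "t = hi")
  case True
  then show ?thesis
    using bias_nonneg_hi by (simp add: d_hi)
next
  case False
  have "d hi * surv yP c hi \<le> d t * surv yP c t"
  proof (rule DERIV_nonpos_imp_decreasing_open[OF assms(2)])
    show "continuous_on {t..hi} (\<lambda>t. d t * surv yP c t)"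
      by (rule continuous_on_subset[OF continuous_d_surv]) (use assms in auto)
    show "\<exists>z. ((\<lambda>t. d t * surv yP c t) has_real_derivative z) (at s) \<and> z \<le> 0"
      if s: "t < s" "s < hi" for s
    proof (intro exI conjI)
      show "((\<lambda>t. d t * surv yP c t) has_real_derivative - dTheta yP s * surv yP c s) (at s)"
        by (rule d_surv_deriv) (use s assms in auto)
      have "0 \<le> dTheta yP s"
        by (rule dTheta_nonneg[OF C1P smP]) (use s assms c hi_le_1 in auto)
      moreover have "0 < surv yP c s"
        by (rule decay_pos) (rule s)
      ultimately show "- dTheta yP s * surv yP c s \<le> 0"
        by simp
    qed
  qed
  moreover have "0 \<le> d hi * surv yP c hi"
    using bias_nonneg_hi surv_end_nonneg[OF C1P smP c] by (simp add: d_hi)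
  ultimately have "0 \<le> d t * surv yP c t"
    by simp
  then show ?thesis
    using decay_pos[of t hi] False assms(2) by (simp add: zero_le_mult_iff not_le[symmetric])
qed

lemma d_deriv:
  assumes "c < t" "t < hi"
  shows "(d has_real_derivative dTheta yP t * (d t / b t - 1)) (at t)"
proof -
  let ?e = "surv yP c"
  have pos: "0 < ?e t" "0 < b t"
    using assms c bias_pos_from[of c t] by (auto simp: decay_pos)
  have "((\<lambda>t. d t * ?e t / ?e t) has_real_derivative
     ((- dTheta yP t * ?e t) * ?e t - (d t * ?e t) * (- (dTheta yP t / b t) * ?e t)) / (?e t * ?e t)) (at t)"
    by (rule DERIV_divide[OF d_surv_deriv surv_deriv[OF C1P smP c]]) (use assms pos in auto)
  also have "((- dTheta yP t * ?e t) * ?e t - (d t * ?e t) * (- (dTheta yP t / b t) * ?e t)) / (?e t * ?e t)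
      = dTheta yP t * (d t / b t - 1)"
    using pos by (simp add: field_simps)
  finally have "((\<lambda>t. d t * ?e t / ?e t) has_real_derivative dTheta yP t * (d t / b t - 1)) (at t)" .
  moreover have "\<forall>\<^sub>F s in nhds t. d s * ?e s / ?e s = d s"
    using eventually_nhds_in_open[of "{..<hi}" t] assms
    by (auto elim!: eventually_mono dest: decay_pos[of _ hi "\<lambda>t. dTheta yP t / b t" c])
  ultimately show ?thesis
    by (rule has_real_derivative_eventually_eq)
qed

text \<open>\<open>surv yP c\<close> is an integrating factor of the equation \<open>d' = yP' (d - b) / b\<close>.\<close>

lemma gap_deriv:
  assumes "c < t" "t < hi"
  shows "((\<lambda>t. surv yP c t * (d t - B)) has_real_derivative
    dTheta yP t / b t * surv yP c t * (B - b t)) (at t)"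
proof -
  have "((\<lambda>t. d t * surv yP c t - B * surv yP c t) has_real_derivative
      - dTheta yP t * surv yP c t - B * (- (dTheta yP t / b t) * surv yP c t)) (at t)"
    by (rule DERIV_diff[OF d_surv_deriv[OF assms] DERIV_cmult[OF surv_deriv[OF C1P smP c assms]]])
  moreover have "- dTheta yP t * surv yP c t - B * (- (dTheta yP t / b t) * surv yP c t)
      = dTheta yP t / b t * surv yP c t * (B - b t)"
    using bias_pos_from[of c t] assms c by (simp add: field_simps)
  moreover have "(\<lambda>t. d t * surv yP c t - B * surv yP c t) = (\<lambda>t. surv yP c t * (d t - B))"
    by (simp add: fun_eq_iff algebra_simps)
  ultimately show ?thesis
    by simp
qed

lemma continuous_gap: "continuous_on {c..hi} (\<lambda>t. surv yP c t * (d t - B))"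
proof -
  have "continuous_on {c..hi} (\<lambda>t. d t * surv yP c t - B * surv yP c t)"
    by (intro continuous_intros continuous_d_surv continuous_surv[OF C1P smP c])
  then show ?thesis
    by (simp add: algebra_simps)
qed

lemma rate_surv_nonneg:
  assumes "c < t" "t < hi"
  shows "0 \<le> dTheta yP t / b t * surv yP c t"
  using rate_nonneg[OF C1P smP c assms] decay_pos[OF assms(2)]
  by (intro mult_nonneg_nonneg) (auto intro: less_imp_le)

end

section \<open>Comparison of \<open>d\<close> with the bias\<close>

text \<open>Against the constant \<open>b \<theta>\<close> the weighted gap decreases, because the
  bias stays above that constant; it starts nonpositive, so
  \<open>d t \<le> b \<theta> \<le> b t\<close>. For an increasing bias the set that defines
  \<open>theta_low\<close> is thus upward closed.\<close>

lemma d_le_bias_upward: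
  assumes mono: "mono_on Theta b" and \<theta>: "0 \<le> \<theta>" "0 < b \<theta>" "d \<theta> \<le> b \<theta>" and t: "\<theta> \<le> t" "t \<le> hi"
  shows "d t \<le> b t"
proof (cases "t = hi")
  case True
  then show ?thesis
    using bias_nonneg_hi by (simp add: d_hi)
next
  case False
  with t have lt: "t < hi" "\<theta> < hi"
    by auto
  note c = \<theta>(1) lt(2) \<theta>(2)
  have "surv yP \<theta> t * (d t - b \<theta>) \<le> surv yP \<theta> \<theta> * (d \<theta> - b \<theta>)"
  proof (rule DERIV_nonpos_imp_decreasing_open[OF t(1)])
    show "continuous_on {\<theta>..t} (\<lambda>t. surv yP \<theta> t * (d t - b \<theta>))"
      by (rule continuous_on_subset[OF continuous_gap[OF c]]) (use lt in auto)
    show "\<exists>z. ((\<lambda>t. surv yP \<theta> t * (d t - b \<theta>)) has_real_derivative z) (at s) \<and> z \<le> 0"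
      if "\<theta> < s" "s < t" for s
    proof (intro exI conjI)
      show "((\<lambda>t. surv yP \<theta> t * (d t - b \<theta>)) has_real_derivative
          dTheta yP s / b s * surv yP \<theta> s * (b \<theta> - b s)) (at s)"
        by (rule gap_deriv[OF c]) (use that lt in auto)
      have "b \<theta> \<le> b s"
        by (rule mono_onD[OF mono]) (use that lt hi_le_1 \<theta> in auto)
      then show "dTheta yP s / b s * surv yP \<theta> s * (b \<theta> - b s) \<le> 0"
        using rate_surv_nonneg[OF c, of s] that lt by (intro mult_nonneg_nonpos) auto
    qed
  qed
  also have "\<dots> \<le> 0"
    using \<theta> lt by (simp add: decay_start)
  finally have "d t \<le> b \<theta>"
    using decay_pos[of t hi "\<lambda>t. dTheta yP t / b t" \<theta>] lt by (simp add: mult_le_0_iff)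
  also have "b \<theta> \<le> b t"
    by (rule mono_onD[OF mono]) (use t lt hi_le_1 \<theta> in auto)
  finally show ?thesis .
qed

text \<open>Now the constant is \<open>b t\<close>, and the weighted gap increases up to
  \<open>hi\<close>, where it is nonpositive because \<open>d hi\<close> is half of
  \<open>b hi\<close> and \<open>b hi \<le> b t\<close>. A decreasing bias therefore puts the cutoff
  at 0.\<close>

lemma d_le_bias_antimono:
  assumes anti: "antimono_on Theta b" and t: "0 \<le> t" "t \<le> hi"
  shows "d t \<le> b t"
proof (cases "t = hi")
  case True
  then show ?thesis
    using bias_nonneg_hi by (simp add: d_hi)
next
  case False
  have anti': "b y \<le> b x" if "0 \<le> x" "x \<le> y" "y \<le> 1" for x y
    using monotone_onD[OF anti, of x y] that by auto
  have "0 < b t"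
    using bias_pos[of t] bias_pos[of "1/2"] anti'[of t "1/2"] t False hi_le_1 by (cases "t = 0") auto
  with t False have c: "0 \<le> t" "t < hi" "0 < b t"
    by auto
  have "surv yP t t * (d t - b t) \<le> surv yP t hi * (d hi - b t)"
  proof (rule DERIV_nonneg_imp_increasing_open[OF t(2) _ continuous_gap[OF c]])
    show "\<exists>z. ((\<lambda>s. surv yP t s * (d s - b t)) has_real_derivative z) (at s) \<and> 0 \<le> z"
      if s: "t < s" "s < hi" for s
    proof (intro exI conjI)
      show "((\<lambda>s. surv yP t s * (d s - b t)) has_real_derivative
          dTheta yP s / b s * surv yP t s * (b t - b s)) (at s)"
        by (rule gap_deriv[OF c s])
      show "0 \<le> dTheta yP s / b s * surv yP t s * (b t - b s)"
        by (rule mult_nonneg_nonneg[OF rate_surv_nonneg[OF c s]])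
           (use anti'[of t s] s t hi_le_1 in auto)
    qed
  qed
  also have "\<dots> \<le> 0"
    using surv_end_nonneg[OF C1P smP c] anti'[of t hi] t hi_le_1 bias_nonneg_hi
    by (intro mult_nonneg_nonpos) (auto simp: d_hi)
  finally show ?thesis
    using c by (simp add: decay_start)
qed

text \<open>\<open>d\<close> is a quotient of continuous functions wherever \<open>surv\<close> is
  nonzero. The latter can vanish only at \<open>hi\<close> and only if \<open>b 1 = 0\<close>; there
  the squeeze \<open>0 \<le> d \<le> b\<close> gives the limit 0.\<close>

lemma continuous_d:
  assumes c: "0 \<le> c" "c < hi" "0 < b c"
  shows "continuous_on {c..hi} d"
proof -
  have quot: "continuous_on S d" if S: "S \<subseteq> {c..hi}" "\<And>t. t \<in> S \<Longrightarrow> surv yP c t \<noteq> 0" for S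
  proof -
    have "continuous_on S (\<lambda>t. d t * surv yP c t / surv yP c t)"
      by (intro continuous_intros continuous_on_subset[OF continuous_d_surv[OF c] S(1)]
          continuous_on_subset[OF continuous_surv[OF C1P smP c] S(1)]) (use S in auto)
    then show ?thesis
      by (rule continuous_on_eq) (use S in auto)
  qed
  have nz: "surv yP c t \<noteq> 0" if "t < hi" for t
    using decay_pos[OF that] by (metis less_irrefl)
  show ?thesis
  proof (cases "b 1 = 0")
    case False
    then have "surv yP c hi \<noteq> 0"
      using decay_end[OF c(2) continuous_rate_closed[OF C1P c(1,3)]] by simp
    then show ?thesis
      using nz by (intro quot) (auto simp: less_le)
  next
    case True
    then have hi: "hi = 1"
      by (rule hi_eq_1)
    have anti: "antimono_on Theta b"
      using bias_mono bias_pos[of "1/2"] True mono_onD[of Theta b "1/2" 1] by auto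
    have "(d \<longlongrightarrow> 0) (at 1 within {c..1})"
    proof (rule tendsto_sandwich)
      show "\<forall>\<^sub>F t in at 1 within {c..1}. 0 \<le> d t"
        using d_nonneg[OF c] hi by (auto simp: eventually_at_filter)
      show "\<forall>\<^sub>F t in at 1 within {c..1}. d t \<le> b t"
        using d_le_bias_antimono[OF anti] hi c by (auto simp: eventually_at_filter)
      show "(b \<longlongrightarrow> 0) (at 1 within {c..1})"
        using continuous_bias_Icc[of c 1] c hi True
        by (auto simp: continuous_on_def dest!: bspec[where x = 1])
    qed simp
    moreover have "(d \<longlongrightarrow> d t) (at t within {c..1})" if t: "t \<in> {c..<1}" for t
    proof -
      have "continuous_on {c..<1} d"
        using nz hi by (intro quot) auto
      moreover have "at t within {c..1} = at t within {c..<1}"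
        by (rule at_within_nhd[of _ "{..<1}"]) (use t in auto)
      ultimately show ?thesis
        using t by (auto simp: continuous_on_def)
    qed
    ultimately have "(d \<longlongrightarrow> d t) (at t within {c..1})" if "t \<in> {c..1}" for t
      using d_hi True hi that by (cases "t = 1") auto
    then show ?thesis
      using hi by (simp add: continuous_on_def)
  qed
qed

text \<open>A decreasing bias gives \<open>lo = 0\<close>. For an increasing one, \<open>d\<close>
  lies above the bias to the left of \<open>lo\<close> and not above it to the right, so continuity
  yields equality at \<open>lo\<close> unless \<open>lo = 0\<close>. The delicate point is a bias
  that vanishes at 0.\<close>

lemma
  shows lo_nonneg: "0 \<le> lo" and lo_less_hi: "lo < hi" and bias_lo: "0 < b lo"
    and d_le_bias: "\<And>t. lo \<le> t \<Longrightarrow> t \<le> hi \<Longrightarrow> d t \<le> b t"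
    and d_lo: "0 < lo \<Longrightarrow> d lo = b lo"
    and bias_le_lo: "\<And>t. 0 \<le> t \<Longrightarrow> t < lo \<Longrightarrow> b t \<le> b lo"
proof -
  define S where "S = {\<theta> \<in> {0..hi}. 0 < b \<theta> \<and> d \<theta> \<le> b \<theta>}"
  have lo: "lo = Inf S"
    by (simp add: S_def theta_low_def)
  have bdd: "bdd_below S"
    by (rule bdd_belowI[of _ 0]) (simp add: S_def)
  have "0 \<le> lo \<and> lo < hi \<and> 0 < b lo \<and> (\<forall>t. lo \<le> t \<and> t \<le> hi \<longrightarrow> d t \<le> b t)
      \<and> (0 < lo \<longrightarrow> d lo = b lo) \<and> (\<forall>t. 0 \<le> t \<and> t < lo \<longrightarrow> b t \<le> b lo)"
    using bias_mono
  proof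
    assume anti: "antimono_on Theta b"
    have "0 < b 0"
      using monotone_onD[OF anti, of 0 "1/2"] bias_pos[of "1/2"] by auto
    then have "0 \<in> S"
      using d_le_bias_antimono[OF anti, of 0] hi_pos by (simp add: S_def)
    then have "lo = 0"
      unfolding lo by (rule cInf_eq_minimum) (simp add: S_def)
    then show ?thesis
      using hi_pos \<open>0 < b 0\<close> d_le_bias_antimono[OF anti] by simp
  next
    assume mono: "mono_on Theta b"
    have "0 < b 1"
      using mono_onD[OF mono, of "1/2" 1] bias_pos[of "1/2"] by auto
    then have bhi: "0 < b hi" and hi1: "hi < 1"
      using bias_pos_hi hi_less_1 by auto
    have hiS: "hi \<in> S"
      using bhi hi_pos d_hi by (simp add: S_def)
    have lo0: "0 \<le> lo"
      unfolding lo using hiS by (intro cInf_greatest) (auto simp: S_def)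
    have lo_hi: "lo \<le> hi"
      unfolding lo by (rule cInf_lower[OF hiS bdd])
    have above: "d t \<le> b t" if t: "lo < t" "t \<le> hi" for t
    proof -
      have "S \<noteq> {}" "Inf S < t"
        using hiS t lo by auto
      then obtain s where "s \<in> S" "s < t"
        using cInf_lessD by blast
      then show ?thesis
        using d_le_bias_upward[OF mono, of s t] t by (simp add: S_def)
    qed
    have below: "b t < d t" if "0 \<le> t" "t < lo" "0 < b t" for t
      using cInf_lower[OF _ bdd, of t] that lo lo_hi by (force simp: S_def)
    \<comment> \<open>If both \<open>lo\<close> and \<open>b 0\<close> were 0, then
      \<open>d \<le> b\<close> on the whole interior would make \<open>d\<close> decreasing, hence
      \<open>b \<ge> d \<ge> b hi / 2\<close> there, and \<open>b\<close> could not tend to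
      0.\<close>
    have "0 < lo" if "b 0 = 0"
    proof (rule ccontr)
      assume "\<not> 0 < lo"
      then have "lo = 0"
        using lo0 by simp
      have "b hi / 2 \<le> b t" if t: "t \<in> {0<..<hi}" for t
      proof -
        have c: "0 \<le> t" "t < hi" "0 < b t"
          using t bias_pos[of t] hi1 by auto
        have "d hi \<le> d t"
        proof (rule DERIV_nonpos_imp_decreasing_open[OF less_imp_le[OF c(2)] _ continuous_d[OF c]])
          show "\<exists>z. (d has_real_derivative z) (at s) \<and> z \<le> 0" if "t < s" "s < hi" for s
          proof (intro exI conjI)
            show "(d has_real_derivative dTheta yP s * (d s / b s - 1)) (at s)"
              by (rule d_deriv[OF c that])
            show "dTheta yP s * (d s / b s - 1) \<le> 0"
              using dTheta_nonneg[OF C1P smP, of s] above[of s] bias_pos[of s] that c hi1 \<open>lo = 0\<close>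
              by (intro mult_nonneg_nonpos) (auto simp: field_simps)
          qed
        qed
        also have "d t \<le> b t"
          using above[of t] c t \<open>lo = 0\<close> by simp
        finally show ?thesis
          by (simp add: d_hi)
      qed
      then have "b hi / 2 \<le> b 0"
        using continuous_ge_on_Ioo[OF continuous_bias_Icc[of 0 hi], of "b hi / 2" 0] hi_pos hi1 by auto
      with \<open>b 0 = 0\<close> bhi show False
        by simp
    qed
    \<comment> \<open>\<open>c\<close> has positive bias and lies strictly to the left of
      \<open>lo\<close> if \<open>lo > 0\<close>, so that \<open>d\<close> is continuous on both
      sides of \<open>lo\<close>.\<close>
    then obtain c where c: "0 \<le> c" "c < hi" "0 < b c" and c_lo: "c = lo \<and> lo = 0 \<or> c < lo"
    proof (cases "lo = 0")
      case True
      then have "0 < b 0"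
        using \<open>b 0 = 0 \<Longrightarrow> 0 < lo\<close> bias_nonneg[of 0] by force
      then show ?thesis
        using that[of 0] hi_pos True by simp
    next
      case False
      then show ?thesis
        using that[of "lo / 2"] lo0 lo_hi hi1 bias_pos[of "lo / 2"] by simp
    qed
    have b_c: "0 < b t" if "c \<le> t" "t \<le> hi" for t
      using bias_pos_from[OF c(1,3), of t] bhi that by (cases "t = hi") auto
    have cont: "continuous_on {c..hi} (\<lambda>t. d t - b t)"
      using c hi_le_1 by (intro continuous_intros continuous_d continuous_bias_Icc)
    have ge: "b lo \<le> d lo" if "c < lo"
    proof -
      have "continuous_on {c..lo} (\<lambda>t. d t - b t)"
        by (rule continuous_on_subset[OF cont]) (use lo_hi in auto)
      then have "0 \<le> d lo - b lo"
        by (rule continuous_ge_on_Ioo[where c = c and d = lo])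
           (use that c below b_c lo_hi in \<open>auto intro: less_imp_le\<close>)
      then show ?thesis
        by simp
    qed
    \<comment> \<open>At \<open>hi\<close> the inequality \<open>b \<le> d\<close> fails, since
      \<open>d hi = b hi / 2\<close> with \<open>b hi > 0\<close>.\<close>
    have lt: "lo < hi"
      using ge lo_hi d_hi bhi c c_lo by (cases "lo = hi") auto
    have le: "d lo \<le> b lo"
    proof -
      have "continuous_on {lo..hi} (\<lambda>t. b t - d t)"
        using continuous_on_minus[OF continuous_on_subset[OF cont, of "{lo..hi}"]] c_lo by auto
      then have "0 \<le> b lo - d lo"
        by (rule continuous_ge_on_Ioo[where c = lo and d = hi]) (use lt above in auto)
      then show ?thesis
        by simp
    qed
    have "d lo = b lo" if "0 < lo"
      using ge le c_lo that by auto
    moreover have "d t \<le> b t" if "lo \<le> t" "t \<le> hi" for t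
      using above[of t] le that by (cases "t = lo") auto
    moreover have "0 < b lo"
      using b_c[of lo] c_lo lo_hi by auto
    moreover have "b t \<le> b lo" if "0 \<le> t" "t < lo" for t
      by (rule mono_onD[OF mono]) (use that lo_hi hi1 in auto)
    ultimately show ?thesis
      using lo0 lt by blast
  qed
  then show "0 \<le> lo" "lo < hi" "0 < b lo" "\<And>t. lo \<le> t \<Longrightarrow> t \<le> hi \<Longrightarrow> d t \<le> b t"
    "0 < lo \<Longrightarrow> d lo = b lo" "\<And>t. 0 \<le> t \<Longrightarrow> t < lo \<Longrightarrow> b t \<le> b lo"
    by blast+
qed

end

section \<open>Mechanisms and their payoffs\<close>

context
  fixes \<alpha> \<beta> m t
  assumes m: "m \<in> mechanisms \<alpha> \<beta>" and t: "t \<in> Theta"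
begin

lemma mechanism_kernel: "prob_space (m t)" "sets (m t) = sets (restrict_space borel {\<alpha>..\<beta>})"
proof -
  have "m t \<in> space (prob_algebra (restrict_space borel {\<alpha>..\<beta>}))"
    using m t by (auto simp: mechanisms_def space_restrict_space intro: measurable_space)
  then show "prob_space (m t)" "sets (m t) = sets (restrict_space borel {\<alpha>..\<beta>})"
    by (auto simp: space_prob_algebra)
qed

interpretation prob_space "m t"
  by (rule mechanism_kernel)

lemma mechanism_space: "space (m t) = {\<alpha>..\<beta>}"
  using sets_eq_imp_space_eq[OF mechanism_kernel(2)] by (simp add: space_restrict_space)

lemma mechanism_integrable:
  fixes g :: "real \<Rightarrow> real"
  assumes "continuous_on UNIV g"
  shows "integrable (m t) g"
proof -
  have "compact (g ` {\<alpha>..\<beta>})"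
    by (intro compact_continuous_image continuous_on_subset[OF assms]) auto
  then obtain B where "\<forall>a\<in>{\<alpha>..\<beta>}. norm (g a) \<le> B"
    by (auto dest!: compact_imp_bounded simp: bounded_iff)
  moreover have "g \<in> borel_measurable (m t)"
    using borel_measurable_continuous_onI[OF assms] measurable_restrict_space1
    by (simp add: measurable_cong_sets[OF mechanism_kernel(2) refl])
  ultimately show ?thesis
    by (intro integrable_const_bound[where B = B]) (auto simp: mechanism_space)
qed

text \<open>The cross term integrates to 0, so a payoff depends on the distribution of actions only
  through its mean and variance.\<close>

lemma payoff_mean_var: "payoff y m s t = - (mech_var m t + (mech_mean m t - y s)\<^sup>2)"
proof -
  let ?\<mu> = "mech_mean m t"
  note int = mechanism_integrable
  have "(\<integral>a. (a - y s)\<^sup>2 \<partial>m t)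
      = (\<integral>a. (a - ?\<mu>)\<^sup>2 + (2 * (?\<mu> - y s) * (a - ?\<mu>) + (?\<mu> - y s)\<^sup>2) \<partial>m t)"
    by (rule Bochner_Integration.integral_cong) (auto simp: power2_eq_square algebra_simps)
  also have "\<dots> = mech_var m t + (2 * (?\<mu> - y s) * (\<integral>a. a - ?\<mu> \<partial>m t) + (?\<mu> - y s)\<^sup>2)"
    by (simp add: mech_var_def int continuous_intros prob_space)
  also have "(\<integral>a. a - ?\<mu> \<partial>m t) = 0"
    using int[of "\<lambda>a. a"] by (simp add: mech_mean_def prob_space)
  finally show ?thesis
    by (simp add: payoff_def)
qed

lemma mech_var_nonneg: "0 \<le> mech_var m t"
  unfolding mech_var_def by (rule Bochner_Integration.integral_nonneg) simp

lemma payoff_nonpos: "payoff y m s t \<le> 0"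
  unfolding payoff_def by (simp add: Bochner_Integration.integral_nonneg)

lemma payoff_ge:
  assumes "y s \<in> {\<alpha>..\<beta>}"
  shows "- (\<beta> - \<alpha>)\<^sup>2 \<le> payoff y m s t"
proof -
  have "(\<integral>a. (a - y s)\<^sup>2 \<partial>m t) \<le> (\<beta> - \<alpha>)\<^sup>2"
  proof (rule integral_le_const)
    show "integrable (m t) (\<lambda>a. (a - y s)\<^sup>2)"
      by (intro mechanism_integrable continuous_intros)
    show "AE a in m t. (a - y s)\<^sup>2 \<le> (\<beta> - \<alpha>)\<^sup>2"
      using assms by (auto intro!: AE_I2 abs_le_square_iff[THEN iffD1] simp: mechanism_space)
  qed
  then show ?thesis
    by (simp add: payoff_def)
qed

end

section \<open>Stieltjes measures of CDFs and lower bounds on \<open>V\<close>\<close>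

lemma real_distribution_interval_measure_cdf:
  assumes "real_distribution N"
  shows "real_distribution (interval_measure (cdf N))" "interval_measure (cdf N) = N"
proof -
  interpret real_distribution N
    by fact
  show *: "real_distribution (interval_measure (cdf N))"
    by (intro real_distribution_interval_measure cdf_nondecreasing cdf_is_right_cont
        cdf_lim_at_bot cdf_lim_at_top_prob)
  have "cdf (interval_measure (cdf N)) = cdf N"
    by (intro cdf_interval_measure cdf_nondecreasing cdf_is_right_cont cdf_lim_at_bot)
  with * assms show "interval_measure (cdf N) = N"
    by (intro cdf_unique)
qed

lemma V_ge:
  assumes F: "F \<in> cdfs" and "0 \<le> C" and ge: "\<And>\<theta>. \<theta> \<in> Theta \<Longrightarrow> - C \<le> payoff y m \<theta> \<theta>"
  shows "- C \<le> V y m F"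
proof -
  obtain N where N: "real_distribution N" "F = cdf N"
    using F by (auto simp: cdfs_def)
  then interpret real_distribution "interval_measure F"
    using real_distribution_interval_measure_cdf by simp
  show ?thesis
  proof (cases "integrable (interval_measure F) (\<lambda>\<theta>. indicator Theta \<theta> *\<^sub>R payoff y m \<theta> \<theta>)")
    case True
    then show ?thesis
      unfolding V_def set_lebesgue_integral_def
      by (rule integral_ge_const) (use ge \<open>0 \<le> C\<close> in \<open>auto simp: indicator_def\<close>)
  next
    \<comment> \<open>A payoff that is not integrable has Bochner integral 0 by default, and
      \<open>0 \<le> C\<close> puts this above \<open>- C\<close>.\<close>
    case False
    then show ?thesis
      using \<open>0 \<le> C\<close> by (simp add: V_def set_lebesgue_integral_def not_integrable_integral_eq)
  qed
qed

section \<open>The saddle point\<close>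

context biased_delegation
begin

section \<open>Incentive compatible mechanisms and the envelope formula\<close>

context
  fixes \<alpha> \<beta> m
  assumes IC: "m \<in> IC_mechanisms \<alpha> \<beta> yA"
begin

lemma IC_mechanism: "m \<in> mechanisms \<alpha> \<beta>"
  using IC by (simp add: IC_mechanisms_def)

lemma IC_payoff_le: "s \<in> Theta \<Longrightarrow> t \<in> Theta \<Longrightarrow> payoff yA m s t \<le> payoff yA m s s"
  using IC by (simp add: IC_mechanisms_def)

abbreviation \<mu> where "\<mu> \<equiv> mech_mean m"
abbreviation UA where "UA t \<equiv> payoff yA m t t"
abbreviation UP where "UP t \<equiv> payoff yP m t t"

text \<open>The variance cancels when the types \<open>s\<close> and \<open>t\<close> evaluate the
  same report \<open>t\<close>, so the incentive constraint becomes linear in the mean.\<close>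

lemma IC_diff:
  assumes "s \<in> Theta" "t \<in> Theta"
  shows "(yA s - yA t) * (2 * \<mu> t - yA s - yA t) \<le> UA s - UA t"
proof -
  have "payoff yA m s t \<le> UA s"
    by (rule IC_payoff_le[OF assms])
  moreover have "payoff yA m s t = UA t + (yA s - yA t) * (2 * \<mu> t - yA s - yA t)"
    unfolding payoff_mean_var[OF IC_mechanism assms(2)]
    by (simp add: power2_eq_square algebra_simps)
  ultimately show ?thesis
    by simp
qed

text \<open>The constraints of \<open>s\<close> and \<open>t\<close> towards each other add up to a
  nonnegative product of the increments of \<open>yA\<close> and \<open>\<mu>\<close>.\<close>

lemma mono_mean: "mono_on Theta \<mu>"
proof (rule mono_onI)
  fix s t :: real assume st: "s \<in> Theta" "t \<in> Theta" "s \<le> t"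
  show "\<mu> s \<le> \<mu> t"
  proof (cases "s = t")
    case False
    then have "0 < yA t - yA s"
      using yA_less_iff[of s t] st by simp
    moreover have "0 \<le> (yA t - yA s) * (\<mu> t - \<mu> s)"
      using IC_diff[of s t] IC_diff[of t s] st by (simp add: algebra_simps)
    ultimately show ?thesis
      by (simp add: zero_le_mult_iff)
  qed simp
qed

text \<open>\<open>UA\<close> is Lipschitz as a function of \<open>yA\<close>, by
  \<open>IC_diff\<close> in both directions. The constant \<open>C\<close> comes from the endpoint
  values of the monotone functions \<open>\<mu>\<close> and \<open>yA\<close>.\<close>

lemma continuous_UA: "continuous_on Theta UA"
  unfolding continuous_on_def
proof
  fix t assume t: "t \<in> Theta"
  define C where "C = 2 * (\<bar>\<mu> 0\<bar> + \<bar>\<mu> 1\<bar>) + 2 * (\<bar>yA 0\<bar> + \<bar>yA 1\<bar>)"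
  have bound: "\<bar>2 * \<mu> r - yA s - yA r'\<bar> \<le> C"
    if "r \<in> Theta" "s \<in> Theta" "r' \<in> Theta" for r r' s
    using that mono_onD[OF mono_mean, of 0 r] mono_onD[OF mono_mean, of r 1]
      yA_le[of 0 s] yA_le[of s 1] yA_le[of 0 r'] yA_le[of r' 1]
    unfolding C_def by auto
  have le: "UA r - UA s \<le> C * \<bar>yA r - yA s\<bar>" if "r \<in> Theta" "s \<in> Theta" for r s
  proof -
    have "UA r - UA s \<le> (yA r - yA s) * (2 * \<mu> r - yA s - yA r)"
      using IC_diff[of s r] that by (simp add: algebra_simps)
    also have "\<dots> \<le> \<bar>yA r - yA s\<bar> * \<bar>2 * \<mu> r - yA s - yA r\<bar>"
      by (metis abs_ge_self abs_mult)
    also have "\<dots> \<le> \<bar>yA r - yA s\<bar> * C"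
      by (intro mult_left_mono bound that) simp
    finally show ?thesis
      by (simp add: mult.commute)
  qed
  have "((\<lambda>s. UA s - UA t) \<longlongrightarrow> 0) (at t within Theta)"
  proof (rule Lim_null_comparison)
    show "\<forall>\<^sub>F s in at t within Theta. norm (UA s - UA t) \<le> C * \<bar>yA s - yA t\<bar>"
      using le[of _ t] le[of t] t by (auto simp: eventually_at_filter abs_le_iff abs_minus_commute)
    have "(yA \<longlongrightarrow> yA t) (at t within Theta)"
      using continuous_ideal t by (auto simp: continuous_on_def)
    then have "((\<lambda>s. C * \<bar>yA s - yA t\<bar>) \<longlongrightarrow> C * \<bar>yA t - yA t\<bar>) (at t within Theta)"
      by (intro tendsto_intros)
    then show "((\<lambda>s. C * \<bar>yA s - yA t\<bar>) \<longlongrightarrow> 0) (at t within Theta)"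
      by simp
  qed
  then show "(UA \<longlongrightarrow> UA t) (at t within Theta)"
    by (simp add: LIM_zero_iff)
qed

text \<open>Envelope formula: \<open>IC_diff\<close> in both directions squeezes the difference
  quotient with respect to \<open>yA\<close> between two expressions that differ by twice the
  increment of \<open>\<mu>\<close>, which tends to 0 at points of continuity.\<close>

lemma UA_deriv:
  assumes t: "0 < t" "t < 1" and cont: "isCont \<mu> t"
  shows "(UA has_real_derivative dTheta yA t * (2 * (\<mu> t - yA t))) (at t)"
proof -
  define g where "g s = (UA s - UA t) / (yA s - yA t)" for s
  have near: "\<forall>\<^sub>F s in at t. s \<in> {0<..<1} \<and> s \<noteq> t"
    using eventually_at_in_open[of "{0<..<1}" t] t by auto
  have yA_t: "(yA has_real_derivative dTheta yA t) (at t)"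
    by (rule C1_has_real_derivative[OF C1A t])
  have yA_lim: "(yA \<longlongrightarrow> yA t) (at t)"
    using DERIV_isCont[OF yA_t] by (simp add: isCont_def)
  have \<mu>_lim: "(\<mu> \<longlongrightarrow> \<mu> t) (at t)"
    using cont by (simp add: isCont_def)
  have "((\<lambda>s. g s - (2 * \<mu> t - yA s - yA t)) \<longlongrightarrow> 0) (at t)"
  proof (rule Lim_null_comparison)
    show "\<forall>\<^sub>F s in at t. norm (g s - (2 * \<mu> t - yA s - yA t)) \<le> 2 * \<bar>\<mu> s - \<mu> t\<bar>"
      using near
    proof eventually_elim
      case (elim s)
      then have s: "s \<in> Theta" "t \<in> Theta" "s \<noteq> t"
        using t by auto
      let ?D = "yA s - yA t"
      have D: "?D \<noteq> 0"
        using s yA_less_iff[of s t] yA_less_iff[of t s] by (cases "s < t") auto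
      have "g s * ?D = UA s - UA t"
        using D by (simp add: g_def)
      then have 1: "0 \<le> ?D * (g s - (2 * \<mu> t - yA s - yA t))"
        and 2: "0 \<le> ?D * ((2 * \<mu> s - yA s - yA t) - g s)"
        using IC_diff[OF s(1,2)] IC_diff[OF s(2,1)] by (simp_all add: algebra_simps)
      show ?case
      proof (cases "0 < ?D")
        case True
        then show ?thesis
          using 1 2 by (simp add: zero_le_mult_iff)
      next
        case False
        then show ?thesis
          using D 1 2 by (simp add: zero_le_mult_iff)
      qed
    qed
    have "((\<lambda>s. 2 * \<bar>\<mu> s - \<mu> t\<bar>) \<longlongrightarrow> 2 * \<bar>\<mu> t - \<mu> t\<bar>) (at t)"
      by (intro tendsto_intros \<mu>_lim)
    then show "((\<lambda>s. 2 * \<bar>\<mu> s - \<mu> t\<bar>) \<longlongrightarrow> 0) (at t)"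
      by simp
  qed
  then have "((\<lambda>s. (g s - (2 * \<mu> t - yA s - yA t)) + (2 * \<mu> t - yA s - yA t))
      \<longlongrightarrow> 0 + (2 * \<mu> t - yA t - yA t)) (at t)"
    by (intro tendsto_intros yA_lim)
  then have "(g \<longlongrightarrow> 2 * (\<mu> t - yA t)) (at t)"
    by (simp add: algebra_simps)
  \<comment> \<open>Back to the quotient with respect to the type; multiplying by the quotient of
    \<open>yA\<close> also covers points where its derivative is 0.\<close>
  then have "((\<lambda>s. (yA s - yA t) / (s - t) * g s) \<longlongrightarrow> dTheta yA t * (2 * (\<mu> t - yA t))) (at t)"
    using yA_t by (intro tendsto_mult) (simp_all add: has_field_derivative_iff)
  moreover have "\<forall>\<^sub>F s in at t. (yA s - yA t) / (s - t) * g s = (UA s - UA t) / (s - t)"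
    using near
  proof eventually_elim
    case (elim s)
    then have "yA s \<noteq> yA t"
      using t yA_less_iff[of s t] yA_less_iff[of t s] by (cases "s < t") auto
    then show ?case
      by (simp add: g_def)
  qed
  ultimately show ?thesis
    unfolding has_field_derivative_iff by (rule Lim_transform_eventually)
qed

lemma UP_eq:
  assumes "t \<in> Theta"
  shows "UP t = UA t - b t * (2 * (\<mu> t - yP t) - b t)"
  unfolding payoff_mean_var[OF IC_mechanism assms] bias_def
  by (simp add: power2_eq_square algebra_simps)

lemma UP_measurable: "(\<lambda>t. indicator Theta t * UP t) \<in> borel_measurable borel"
proof -
  have "(\<lambda>t. UA t - b t * (2 * (\<mu> t - yP t) - b t)) \<in> borel_measurable (restrict_space borel Theta)"
    using borel_measurable_mono_on_fnc[OF mono_mean]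
      borel_measurable_continuous_on_restrict[OF continuous_UA]
      borel_measurable_continuous_on_restrict[OF continuous_bias]
      borel_measurable_continuous_on_restrict[OF continuous_ideal(1)]
    by measurable
  then have "(\<lambda>t. indicator Theta t *\<^sub>R (UA t - b t * (2 * (\<mu> t - yP t) - b t))) \<in> borel_measurable borel"
    by (subst (asm) borel_measurable_restrict_space_iff) auto
  also have "(\<lambda>t. indicator Theta t *\<^sub>R (UA t - b t * (2 * (\<mu> t - yP t) - b t)))
      = (\<lambda>t. indicator Theta t * UP t)"
    by (auto simp: indicator_def UP_eq)
  finally show ?thesis .
qed

end

section \<open>The distribution \<open>F_star\<close> and the payoffs against it\<close>

abbreviation E where "E \<equiv> surv yA lo"
text \<open>The mass that \<open>F_star\<close> places above \<open>lo\<close>; the rest is an atom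
  at \<open>lo\<close>, which is absent when \<open>lo > 0\<close> because then
  \<open>d lo = b lo\<close>.\<close>

definition K where "K = d lo / b lo"
text \<open>Minus the derivative of \<open>E\<close>: up to the factor \<open>K\<close> the density
  of \<open>F_star\<close> between \<open>lo\<close> and \<open>hi\<close>.\<close>

definition dens where "dens t = dTheta yA t / b t * E t"

lemmas E_deriv = surv_deriv[OF C1A smA lo_nonneg lo_less_hi bias_lo]
  and continuous_E = continuous_surv[OF C1A smA lo_nonneg lo_less_hi bias_lo]
  and E_nonneg = surv_nonneg[OF C1A smA lo_nonneg lo_less_hi bias_lo]

lemma E_lo: "E lo = 1"
  by (rule decay_start[OF lo_less_hi])

lemma K_nonneg: "0 \<le> K" and K_le_1: "K \<le> 1" and K_bias: "K * b lo = d lo"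
  using d_nonneg[OF lo_nonneg lo_less_hi bias_lo order_refl] d_le_bias[of lo] bias_lo lo_less_hi
  by (auto simp: K_def)

lemma dens_nonneg:
  assumes "lo < t" "t < hi"
  shows "0 \<le> dens t"
  unfolding dens_def
  using rate_nonneg[OF C1A smA lo_nonneg lo_less_hi bias_lo assms] E_nonneg[of t] assms
  by (intro mult_nonneg_nonneg) auto

lemma dens_integral:
  assumes "lo \<le> x" "x \<le> hi"
  shows "(dens has_integral (1 - E x)) {lo..x}"
proof -
  have "(dens has_integral (- E x - (- E lo))) {lo..x}"
  proof (rule fundamental_theorem_of_calculus_countable[where S = "{}"])
    show "continuous_on {lo..x} (\<lambda>t. - E t)"
      by (intro continuous_intros continuous_on_subset[OF continuous_E]) (use assms in auto)
    show "((\<lambda>t. - E t) has_real_derivative dens t) (at t)" if "t \<in> {lo<..<x} - {}" for t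
      using DERIV_minus[OF E_deriv[of t]] that assms by (simp add: dens_def)
  qed (use assms in auto)
  then show ?thesis
    by (simp add: E_lo)
qed

lemma dens_measurable: "(\<lambda>t. indicator {lo<..<hi} t * dens t) \<in> borel_measurable borel"
proof -
  have "continuous_on {lo<..<hi} dens"
    unfolding dens_def
    by (intro continuous_intros continuous_on_subset[OF continuous_E]
        continuous_on_subset[OF continuous_rate[OF C1A lo_nonneg bias_lo]]) auto
  then have "(\<lambda>t. indicator {lo<..<hi} t *\<^sub>R dens t) \<in> borel_measurable borel"
    by (intro borel_measurable_continuous_on_indicator) auto
  then show ?thesis
    by simp
qed

text \<open>\<open>F_star\<close> has atoms \<open>1 - K\<close> at \<open>lo\<close> and
  \<open>K * E hi\<close> at 1 and the density \<open>K * dens\<close> on the interval from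
  \<open>lo\<close> to \<open>hi\<close>; the masses add up to 1 because \<open>dens\<close>
  integrates to \<open>1 - E hi\<close>.\<close>

lemma star_distribution:
  shows "F_star yP yA \<in> cdfs"
    and "\<And>u I. u \<in> borel_measurable borel \<Longrightarrow> (\<And>x. 0 \<le> u x) \<Longrightarrow> ((\<lambda>x. dens x * u x) has_integral I) {lo..hi} \<Longrightarrow>
      (\<integral>\<^sup>+x. ennreal (u x) \<partial>interval_measure (F_star yP yA))
        = ennreal ((1 - K) * u lo + K * I + K * E hi * u 1)"
proof -
  have "((\<lambda>x. K * dens x) has_integral K * (1 - E hi)) {lo..hi}"
    using lo_less_hi by (intro has_integral_mult_right dens_integral) auto
  then have total: "((\<lambda>x. K * dens x) has_integral (1 - (1 - K) - K * E hi)) {lo..hi}"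
    by (simp add: algebra_simps)
  have meas: "(\<lambda>x. indicator {lo<..<hi} x * (K * dens x)) \<in> borel_measurable borel"
    using borel_measurable_times[OF borel_measurable_const[of K] dens_measurable]
    by (simp add: ac_simps)
  obtain N where N: "real_distribution N"
    and Nint0: "\<And>u I. u \<in> borel_measurable borel \<Longrightarrow> (\<And>x. 0 \<le> u x) \<Longrightarrow>
       ((\<lambda>x. K * dens x * u x) has_integral I) {lo..hi} \<Longrightarrow>
       (\<integral>\<^sup>+x. ennreal (u x) \<partial>N) = ennreal ((1 - K) * u lo + I + K * E hi * u 1)"
    by (rule atom_density_mixture[OF lo_less_hi hi_le_1 _ _ _ meas total])
       (use K_nonneg K_le_1 E_nonneg[of hi] dens_nonneg in \<open>auto intro!: mult_nonneg_nonneg\<close>)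
  have Nint: "(\<integral>\<^sup>+x. ennreal (u x) \<partial>N) = ennreal ((1 - K) * u lo + K * I + K * E hi * u 1)"
    if "u \<in> borel_measurable borel" "\<And>x. 0 \<le> u x" "((\<lambda>x. dens x * u x) has_integral I) {lo..hi}"
    for u I
    using has_integral_mult_right[OF that(3), of K] that(1,2) by (intro Nint0) (auto simp: ac_simps)
  interpret real_distribution N
    by fact
  have meas_N: "measure N A = (1 - K) * indicator A lo + K * I + K * E hi * indicator A 1"
    if A: "A \<in> sets borel" and I: "((\<lambda>x. if x \<in> A then dens x else 0) has_integral I) {lo..hi}" for A I
  proof -
    have I': "((\<lambda>x. dens x * indicator A x) has_integral I) {lo..hi}"
      by (rule has_integral_eq[OF _ I]) (auto simp: indicator_def)
    have "((\<lambda>x. indicator A x * dens x) has_integral I) {lo<..<hi}"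
      using I' by (simp add: has_integral_Icc_iff_Ioo mult.commute)
    then have "0 \<le> I"
      by (rule has_integral_nonneg) (use dens_nonneg in auto)
    have "emeasure N A = (\<integral>\<^sup>+x. ennreal (indicator A x) \<partial>N)"
      using A by (simp add: ennreal_indicator)
    also have "\<dots> = ennreal ((1 - K) * indicator A lo + K * I + K * E hi * indicator A 1)"
      by (rule Nint[OF _ _ I']) (use A in auto)
    finally show ?thesis
      using \<open>0 \<le> I\<close> K_nonneg K_le_1 E_nonneg[of hi]
      by (intro measure_eq_emeasure_eq_ennreal add_nonneg_nonneg mult_nonneg_nonneg) auto
  qed
  have cdf: "cdf N = F_star yP yA"
  proof
    fix x
    show "cdf N x = F_star yP yA x"
    proof (cases "x < lo")
      case True
      have "((\<lambda>t. if t \<in> {..x} then dens t else 0) has_integral 0) {lo..hi}"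
        by (rule has_integral_is_0) (use True in auto)
      then show ?thesis
        unfolding cdf_def using True lo_less_hi hi_le_1
        by (subst meas_N) (auto simp: F_star_def)
    next
      case False
      define z where "z = min x hi"
      have "((\<lambda>t. if t \<in> {lo..z} then dens t else 0) has_integral (1 - E z)) {lo..hi}"
        using dens_integral[of z] False lo_less_hi by (subst has_integral_restrict) (auto simp: z_def)
      then have "((\<lambda>t. if t \<in> {..x} then dens t else 0) has_integral (1 - E z)) {lo..hi}"
        by (rule has_integral_eq[rotated]) (auto simp: z_def)
      then have *: "cdf N x = (1 - K) + K * (1 - E z) + K * E hi * indicator {..x} 1"
        unfolding cdf_def using False by (subst meas_N) auto
      show ?thesis
      proof (cases "x < 1")
        case True
        \<comment> \<open>Below 1, \<open>z\<close> can reach \<open>hi\<close> only if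
          \<open>hi < 1\<close>, hence with nonzero bias at 1, so that \<open>discount\<close>
          agrees with \<open>E\<close> there too.\<close>
        then have "z < hi \<or> z = hi \<and> b 1 \<noteq> 0"
          using hi_eq_1 by (auto simp: z_def)
        then have "discount yP yA yA lo z = E z"
          using discount_eq[OF C1A smA lo_nonneg lo_less_hi bias_lo order_refl, of z] False lo_less_hi
          by (auto simp: z_def E_lo)
        then show ?thesis
          using True False * by (simp add: F_star_def K_def z_def algebra_simps)
      next
        case False
        then show ?thesis
          using * \<open>\<not> x < lo\<close> hi_le_1 by (simp add: F_star_def z_def algebra_simps)
      qed
    qed
  qed
  have "((\<lambda>t. if t \<in> Theta then dens t else 0) has_integral (1 - E hi)) {lo..hi}"
    by (rule has_integral_eq[OF _ dens_integral[of hi]])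
       (use lo_nonneg hi_le_1 lo_less_hi in auto)
  then have "measure N Theta = 1"
    using lo_nonneg lo_less_hi hi_le_1 by (subst meas_N) (auto simp: algebra_simps)
  then show "F_star yP yA \<in> cdfs"
    unfolding cdfs_def using N cdf[symmetric] by blast
  show "(\<integral>\<^sup>+x. ennreal (u x) \<partial>interval_measure (F_star yP yA))
        = ennreal ((1 - K) * u lo + K * I + K * E hi * u 1)"
    if "u \<in> borel_measurable borel" "\<And>x. 0 \<le> u x" "((\<lambda>x. dens x * u x) has_integral I) {lo..hi}"
    for u I
    using Nint[OF that] real_distribution_interval_measure_cdf(2)[OF N] by (simp add: cdf)
qed

text \<open>An equation rather than a bound, so that it yields both the upper bound for all
  mechanisms and the value at the candidate.\<close>

lemma V_star_eq:
  assumes IC: "m \<in> IC_mechanisms \<alpha> \<beta> yA"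
  shows "V yP m (F_star yP yA) = - mech_var m lo - (mech_mean m lo - yP lo - d lo)\<^sup>2 - (d lo)\<^sup>2
    + K * E hi * (payoff yP m 1 1 - payoff yA m hi hi)"
proof -
  let ?\<mu> = "mech_mean m" and ?UA = "\<lambda>t. payoff yA m t t" and ?UP = "\<lambda>t. payoff yP m t t"
  note mech = IC_mechanism[OF IC]
  have in_Theta: "lo \<in> Theta" "hi \<in> Theta" "1 \<in> Theta" "t \<in> {lo..hi} \<Longrightarrow> t \<in> Theta" for t
    using lo_nonneg lo_less_hi hi_le_1 by auto
  text \<open>\<open>H' = dens * UP\<close>: the term in the mean that comes from the derivative of \<open>UA\<close> equals the one
    in \<open>UP_eq\<close>, because \<open>b * dens = yA' * E\<close>.\<close>
  define H where "H t = E t * (b t * (2 * d t - b t) - ?UA t)" for t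
  define S where "S = {t \<in> Theta. \<not> continuous (at t within Theta) ?\<mu>}"
  have "((\<lambda>t. dens t * ?UP t) has_integral (H hi - H lo)) {lo..hi}"
  proof (rule fundamental_theorem_of_calculus_countable[where S = S])
    show "countable S"
      unfolding S_def by (rule mono_on_ctble_discont[OF mono_mean[OF IC]])
    show "continuous_on {lo..hi} H"
      unfolding H_def using lo_nonneg hi_le_1
      by (intro continuous_intros continuous_E continuous_bias_Icc
          continuous_d[OF lo_nonneg lo_less_hi bias_lo]
          continuous_on_subset[OF continuous_UA[OF IC]]) auto
    fix t assume t: "t \<in> {lo<..<hi} - S"
    then have t': "lo < t" "t < hi" "0 < t" "t < 1" "t \<in> Theta"
      using lo_nonneg hi_le_1 by auto
    have "isCont ?\<mu> t"
      using t t' by (auto simp: S_def at_within_Icc_at)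
    note UA' = UA_deriv[OF IC t'(3,4) this]
    have b': "(b has_real_derivative (dTheta yA t - dTheta yP t)) (at t)"
      unfolding bias_def[abs_def]
      by (intro DERIV_diff C1_has_real_derivative C1A C1P t')
    have bt: "b t \<noteq> 0"
      using bias_pos[OF t'(3,4)] by simp
    note d' = d_deriv[OF lo_nonneg lo_less_hi bias_lo t'(1,2)]
    have "(H has_real_derivative
        (- (dTheta yA t / b t) * E t) * (b t * (2 * d t - b t) - ?UA t)
        + ((dTheta yA t - dTheta yP t) * (2 * d t - b t)
           + (2 * (dTheta yP t * (d t / b t - 1)) - (dTheta yA t - dTheta yP t)) * b t
           - dTheta yA t * (2 * (?\<mu> t - yA t))) * E t) (at t)"
      unfolding H_def[abs_def]
      by (intro DERIV_mult DERIV_diff DERIV_cmult E_deriv b' d' UA' t')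
    also have "(- (dTheta yA t / b t) * E t) * (b t * (2 * d t - b t) - ?UA t)
        + ((dTheta yA t - dTheta yP t) * (2 * d t - b t)
           + (2 * (dTheta yP t * (d t / b t - 1)) - (dTheta yA t - dTheta yP t)) * b t
           - dTheta yA t * (2 * (?\<mu> t - yA t))) * E t = dens t * ?UP t"
      unfolding UP_eq[OF IC t'(5)] dens_def using bt
      by (simp add: yA_eq field_simps)
    finally show "(H has_real_derivative dens t * ?UP t) (at t)" .
  qed (use lo_less_hi in auto)
  then have I: "((\<lambda>t. dens t * - (indicator Theta t * ?UP t)) has_integral - (H hi - H lo)) {lo..hi}"
    by (intro has_integral_eq[OF _ has_integral_neg]) (use in_Theta in auto)
  \<comment> \<open>The formula for \<open>F_star\<close> is for nonnegative integrands, so it is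
    applied to the loss of the principal.\<close>
  have "(\<integral>\<^sup>+t. ennreal (- (indicator Theta t * ?UP t)) \<partial>interval_measure (F_star yP yA))
      = ennreal ((1 - K) * - (indicator Theta lo * ?UP lo) + K * - (H hi - H lo)
          + K * E hi * - (indicator Theta 1 * ?UP 1))"
    by (rule star_distribution(2)[OF _ _ I])
       (use UP_measurable[OF IC] payoff_nonpos[OF mech] in \<open>auto simp: indicator_def\<close>)
  also have "\<dots> = ennreal ((1 - K) * - ?UP lo + K * - (H hi - H lo) + K * E hi * - ?UP 1)"
    using in_Theta by simp
  finally have nn: "(\<integral>\<^sup>+t. ennreal (- (indicator Theta t * ?UP t)) \<partial>interval_measure (F_star yP yA))
      = ennreal ((1 - K) * - ?UP lo + K * - (H hi - H lo) + K * E hi * - ?UP 1)" .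
  have "H hi - H lo \<le> 0"
  proof -
    have "((\<lambda>t. dens t * - (indicator Theta t * ?UP t)) has_integral - (H hi - H lo)) {lo<..<hi}"
      using I by (simp add: has_integral_Icc_iff_Ioo)
    then have "0 \<le> - (H hi - H lo)"
      by (rule has_integral_nonneg)
         (use dens_nonneg payoff_nonpos[OF mech] in
           \<open>auto simp: indicator_def intro!: mult_nonneg_nonpos\<close>)
    then show ?thesis
      by simp
  qed
  then have pos: "0 \<le> (1 - K) * - ?UP lo + K * - (H hi - H lo) + K * E hi * - ?UP 1"
    using K_nonneg K_le_1 E_nonneg[of hi] payoff_nonpos[OF mech] in_Theta
    by (intro add_nonneg_nonneg mult_nonneg_nonneg) auto
  have "V yP m (F_star yP yA)
      = - (\<integral>t. - (indicator Theta t * ?UP t) \<partial>interval_measure (F_star yP yA))"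
    by (simp add: V_def set_lebesgue_integral_def)
  also have "(\<integral>t. - (indicator Theta t * ?UP t) \<partial>interval_measure (F_star yP yA))
      = (1 - K) * - ?UP lo + K * - (H hi - H lo) + K * E hi * - ?UP 1"
  proof -
    have "(\<integral>t. - (indicator Theta t * ?UP t) \<partial>interval_measure (F_star yP yA))
        = enn2real (\<integral>\<^sup>+t. ennreal (- (indicator Theta t * ?UP t)) \<partial>interval_measure (F_star yP yA))"
      by (rule integral_eq_nn_integral)
         (use UP_measurable[OF IC] payoff_nonpos[OF mech] in \<open>auto simp: indicator_def\<close>)
    then show ?thesis
      unfolding nn using pos by simp
  qed
  finally have V: "V yP m (F_star yP yA) = (1 - K) * ?UP lo + K * (H hi - H lo) + K * E hi * ?UP 1"
    by (simp add: algebra_simps)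
  have H: "H hi = - E hi * ?UA hi" "H lo = b lo * (2 * d lo - b lo) - ?UA lo"
    by (auto simp: H_def d_hi E_lo)
  have UP_lo: "?UP lo = - (mech_var m lo + (?\<mu> lo - yP lo)\<^sup>2)"
    and UA_lo: "?UA lo = - (mech_var m lo + (?\<mu> lo - yP lo - b lo)\<^sup>2)"
    by (simp_all add: payoff_mean_var[OF mech in_Theta(1)] bias_def)
  \<comment> \<open>Write \<open>x\<close> for the mean at \<open>lo\<close> minus
    \<open>yP lo\<close>. With \<open>K * b lo = d lo\<close> the terms at \<open>lo\<close>
    collapse to minus the variance plus \<open>- x^2 + 2 x d lo - 2 (d lo)^2\<close>, where the
    square is completed.\<close>
  show ?thesis
    unfolding V H UP_lo UA_lo K_bias[symmetric]
    by (simp add: power2_eq_square algebra_simps)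
qed

text \<open>The agent of type \<open>hi\<close> has the ideal action of the principal at 1, so the
  report 1 gives both the same payoff. The incentive constraint of \<open>hi\<close> therefore makes
  the last term of \<open>V_star_eq\<close> nonpositive.\<close>

lemma V_star_le:
  assumes IC: "m \<in> IC_mechanisms \<alpha> \<beta> yA"
  shows "V yP m (F_star yP yA) \<le> - (d lo)\<^sup>2"
proof -
  note mech = IC_mechanism[OF IC]
  have "payoff yA m hi 1 \<le> payoff yA m hi hi"
    by (rule IC_payoff_le[OF IC theta_bar_in]) simp
  moreover have "payoff yA m hi 1 = payoff yP m 1 1"
    using payoff_mean_var[OF mech, of 1] by (simp add: yA_theta_bar)
  ultimately have "K * E hi * (payoff yP m 1 1 - payoff yA m hi hi) \<le> 0"
    using K_nonneg E_nonneg[of hi] by (intro mult_nonneg_nonpos mult_nonneg_nonneg) auto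
  moreover have "0 \<le> mech_var m lo"
    by (rule mech_var_nonneg[OF mech]) (use lo_nonneg lo_less_hi hi_le_1 in auto)
  ultimately show ?thesis
    unfolding V_star_eq[OF IC] by (smt (verit) zero_le_power2)
qed

section \<open>The candidate mechanism\<close>

context
  fixes \<alpha> \<beta> m
  assumes ranges: "yP ` Theta \<subseteq> {\<alpha>..\<beta>}"
    and mech: "m \<in> mechanisms \<alpha> \<beta>"
    and mean: "\<And>t. t \<in> Theta \<Longrightarrow> mech_mean m t = mu_star yP yA t"
    and var: "\<And>t. t \<in> Theta \<Longrightarrow> mech_var m t = tau_star yP yA t"
begin

text \<open>Payoff of the agent of type \<open>\<theta>\<close> from a report \<open>s\<close>
  between \<open>lo\<close> and \<open>hi\<close>, written through \<open>d\<close> so that it can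
  be differentiated in \<open>s\<close>.\<close>

definition W where "W \<theta> s = - ((d lo)\<^sup>2 - (d s)\<^sup>2 + (yP s + d s - yA \<theta>)\<^sup>2)"

lemma payoff_star:
  assumes "t \<in> Theta"
  shows "payoff y m \<theta> t = - (tau_star yP yA t + (mu_star yP yA t - y \<theta>)\<^sup>2)"
  using payoff_mean_var[OF mech assms] mean[OF assms] var[OF assms] by simp

lemma bias_hi: "b hi = yP 1 - yP hi"
  by (simp add: bias_def yA_theta_bar)

text \<open>Reports above \<open>hi\<close> are pooled with \<open>hi\<close>: the last branches of
  mean and variance repeat the values at \<open>hi\<close>, because \<open>d hi = b hi / 2\<close>
  and \<open>b hi = yP 1 - yP hi\<close>.\<close>

lemma star_above_lo:
  assumes "lo \<le> t"
  shows "mu_star yP yA t = yP (min t hi) + d (min t hi)"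
    and "tau_star yP yA t = (d lo)\<^sup>2 - (d (min t hi))\<^sup>2"
  using assms by (auto simp: mu_star_def tau_star_def d_hi bias_hi power2_eq_square field_simps)

lemma payoff_star_above:
  assumes "t \<in> Theta" "lo \<le> t"
  shows "payoff yA m \<theta> t = W \<theta> (min t hi)"
  using payoff_star[OF assms(1)] star_above_lo[OF assms(2)] by (simp add: W_def)

lemma payoff_star_below:
  assumes "t \<in> Theta" "t < lo"
  shows "payoff yA m \<theta> t = - (yA t - yA \<theta>)\<^sup>2"
  using payoff_star[OF assms(1)] assms(2) by (simp add: mu_star_def tau_star_def)

text \<open>By the equation for \<open>d\<close> the derivative is a nonnegative multiple of
  \<open>yA \<theta> - yA s\<close>, so \<open>W \<theta>\<close> peaks at the true type.\<close>

lemma W_deriv: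
  assumes "lo < s" "s < hi"
  shows "(W \<theta> has_real_derivative 2 * (dTheta yP s * d s / b s) * (yA \<theta> - yA s)) (at s)"
proof -
  have s: "0 < s" "s < 1"
    using assms lo_nonneg hi_le_1 by auto
  have bs: "b s \<noteq> 0"
    using bias_pos[OF s] by simp
  note d' = d_deriv[OF lo_nonneg lo_less_hi bias_lo assms]
  note yP' = C1_has_real_derivative[OF C1P s]
  have "(W \<theta> has_real_derivative
      - (- (2 * d s * (dTheta yP s * (d s / b s - 1)))
         + 2 * (yP s + d s - yA \<theta>) * (dTheta yP s + dTheta yP s * (d s / b s - 1)))) (at s)"
    unfolding W_def[abs_def] by (auto intro!: derivative_eq_intros d' yP')
  also have "- (- (2 * d s * (dTheta yP s * (d s / b s - 1)))
         + 2 * (yP s + d s - yA \<theta>) * (dTheta yP s + dTheta yP s * (d s / b s - 1)))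
      = 2 * (dTheta yP s * d s / b s) * (yA \<theta> - yA s)"
    using bs by (simp add: yA_eq[of s] field_simps)
  finally show ?thesis .
qed

lemma W_rate_nonneg:
  assumes "lo < s" "s < hi"
  shows "0 \<le> 2 * (dTheta yP s * d s / b s)"
  using assms lo_nonneg hi_le_1 dTheta_nonneg[OF C1P smP, of s] bias_pos[of s]
    d_nonneg[OF lo_nonneg lo_less_hi bias_lo, of s] by simp

lemma continuous_W: "lo \<le> u \<Longrightarrow> v \<le> hi \<Longrightarrow> continuous_on {u..v} (W \<theta>)"
  unfolding W_def using lo_nonneg hi_le_1
  by (intro continuous_intros continuous_on_subset[OF continuous_d[OF lo_nonneg lo_less_hi bias_lo]]
      continuous_on_subset[OF continuous_ideal(1)]) auto

lemma W_increasing: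
  assumes "lo \<le> s" "s \<le> s'" "s' \<le> hi" "s' \<le> \<theta>" "\<theta> \<in> Theta"
  shows "W \<theta> s \<le> W \<theta> s'"
proof (rule DERIV_nonneg_imp_increasing_open[OF assms(2) _ continuous_W[OF assms(1,3)]])
  fix r assume "s < r" "r < s'"
  then have r: "lo < r" "r < hi" "0 \<le> r" "r \<le> \<theta>"
    using assms lo_nonneg by auto
  show "\<exists>z. (W \<theta> has_real_derivative z) (at r) \<and> 0 \<le> z"
    by (intro exI conjI, rule W_deriv[OF r(1,2)], rule mult_nonneg_nonneg[OF W_rate_nonneg[OF r(1,2)]])
       (use yA_le[of r \<theta>] r assms(5) in auto)
qed

lemma W_decreasing:
  assumes "lo \<le> s" "s \<le> s'" "s' \<le> hi" "\<theta> \<le> s" "\<theta> \<in> Theta"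
  shows "W \<theta> s' \<le> W \<theta> s"
proof (rule DERIV_nonpos_imp_decreasing_open[OF assms(2) _ continuous_W[OF assms(1,3)]])
  fix r assume "s < r" "r < s'"
  then have r: "lo < r" "r < hi" "r \<le> 1" "\<theta> \<le> r"
    using assms hi_le_1 by auto
  show "\<exists>z. (W \<theta> has_real_derivative z) (at r) \<and> z \<le> 0"
    by (intro exI conjI, rule W_deriv[OF r(1,2)], rule mult_nonneg_nonpos[OF W_rate_nonneg[OF r(1,2)]])
       (use yA_le[of \<theta> r] r assms(5) in auto)
qed

text \<open>Types below \<open>lo\<close> get their ideal action for certain. For the others
  \<open>W\<close> is single-peaked, with pooling above \<open>hi\<close>. A report below
  \<open>lo\<close> is no better than \<open>lo\<close>: it exists only if \<open>lo > 0\<close>,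
  and then \<open>d lo = b lo\<close>, so that \<open>lo\<close> gives the sure action
  \<open>yA lo\<close>.\<close>

lemma star_IC: "m \<in> IC_mechanisms \<alpha> \<beta> yA"
proof -
  have "payoff yA m \<theta> t \<le> payoff yA m \<theta> \<theta>" if \<theta>: "\<theta> \<in> Theta" and t: "t \<in> Theta" for \<theta> t
  proof (cases "\<theta> < lo")
    case True
    then show ?thesis
      using payoff_nonpos[OF mech t] payoff_star_below[OF \<theta>] by simp
  next
    case False
    then have \<theta>lo: "lo \<le> \<theta>"
      by simp
    note own = payoff_star_above[OF \<theta> \<theta>lo]
    show ?thesis
    proof (cases "t < lo")
      case True
      then have "0 < lo"
        using t by simp
      have "yA t \<le> yA lo" "yA lo \<le> yA \<theta>"
        using yA_le[of t lo] yA_le[of lo \<theta>] True t \<theta> \<theta>lo by auto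
      then have "(yA lo - yA \<theta>)\<^sup>2 \<le> (yA t - yA \<theta>)\<^sup>2"
        by (intro abs_le_square_iff[THEN iffD1]) simp
      then have "payoff yA m \<theta> t \<le> W \<theta> lo"
        using d_lo[OF \<open>0 < lo\<close>] by (simp add: payoff_star_below[OF t True] W_def bias_def)
      also have "\<dots> \<le> W \<theta> (min \<theta> hi)"
        by (rule W_increasing) (use \<theta>lo lo_less_hi \<theta> in auto)
      finally show ?thesis
        by (simp add: own)
    next
      case False
      then have tlo: "lo \<le> t"
        by simp
      have "W \<theta> (min t hi) \<le> W \<theta> (min \<theta> hi)"
      proof (cases "t \<le> \<theta>")
        case True
        then show ?thesis
          using tlo lo_less_hi \<theta> by (intro W_increasing) auto
      next
        case False
        then have "t > \<theta>"
          by simp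
        then show ?thesis
        proof (cases "\<theta> \<le> hi")
          case True
          then show ?thesis
            using \<theta>lo \<theta> \<open>t > \<theta>\<close> by (intro W_decreasing) auto
        next
          case False
          then show ?thesis
            using \<open>t > \<theta>\<close> by simp
        qed
      qed
      then show ?thesis
        by (simp add: own payoff_star_above[OF t tlo])
    qed
  qed
  then show ?thesis
    using mech by (simp add: IC_mechanisms_def)
qed

text \<open>Below \<open>lo\<close> the loss is the squared bias, and
  \<open>b t \<le> b lo = d lo\<close>. Up to \<open>hi\<close> it is exactly the square of
  \<open>d lo\<close>. Above \<open>hi\<close> the mean is the midpoint of \<open>yP hi\<close> and
  \<open>yP 1\<close>, hence within \<open>d hi\<close> of \<open>yP t\<close>.\<close>

lemma star_payoff_ge:
  assumes t: "t \<in> Theta"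
  shows "- (d lo)\<^sup>2 \<le> payoff yP m t t"
proof (cases "t < lo")
  case True
  then have "0 < lo"
    using t by simp
  then have "b t \<le> d lo" "0 \<le> b t"
    using bias_le_lo[of t] d_lo bias_nonneg t True by auto
  then have "(b t)\<^sup>2 \<le> (d lo)\<^sup>2"
    by (rule power_mono)
  then show ?thesis
    using True by (simp add: payoff_star[OF t] mu_star_def tau_star_def bias_def)
next
  case False
  then have lo_t: "lo \<le> t"
    by simp
  have "\<bar>yP (min t hi) + d (min t hi) - yP t\<bar> \<le> d (min t hi)"
  proof (cases "t \<le> hi")
    case True
    then show ?thesis
      using d_nonneg[OF lo_nonneg lo_less_hi bias_lo lo_t] by simp
  next
    case False
    then have "yP hi \<le> yP t" "yP t \<le> yP 1"
      using yP_le[of hi t] yP_le[of t 1] hi_pos t by auto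
    then show ?thesis
      using False d_hi bias_hi by (simp add: abs_le_iff field_simps)
  qed
  then have "(yP (min t hi) + d (min t hi) - yP t)\<^sup>2 \<le> (d (min t hi))\<^sup>2"
    by (metis abs_ge_zero power2_abs power_mono)
  then show ?thesis
    by (simp add: payoff_star[OF t] star_above_lo[OF lo_t])
qed

text \<open>The extra terms of \<open>V_star_eq\<close> vanish: at \<open>lo\<close> the variance is
  0 and the mean is \<open>yP lo + d lo\<close>, and the payoffs at \<open>hi\<close> and 1
  coincide.\<close>

lemma V_star: "V yP m (F_star yP yA) = - (d lo)\<^sup>2"
proof -
  have in_Theta: "lo \<in> Theta" "hi \<in> Theta" "1 \<in> Theta"
    using lo_nonneg lo_less_hi hi_le_1 by auto
  have "payoff yP m 1 1 = - (d lo)\<^sup>2" "payoff yA m hi hi = - (d lo)\<^sup>2"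
    using payoff_star[of 1 yP 1] payoff_star[of hi yA hi] star_above_lo[of 1] star_above_lo[of hi]
      in_Theta lo_less_hi hi_le_1
    by (simp_all add: d_hi bias_hi yA_theta_bar power2_eq_square field_simps)
  moreover have "mech_mean m lo - yP lo - d lo = 0" "mech_var m lo = 0"
    using mean[of lo] var[of lo] star_above_lo[of lo] in_Theta lo_less_hi by simp_all
  ultimately show ?thesis
    by (simp add: V_star_eq[OF star_IC])
qed

section \<open>The minimax argument\<close>

text \<open>A real infimum is below every member only for a set bounded below; the compact action
  interval provides the bound.\<close>

lemma worst_case_le:
  assumes "m' \<in> IC_mechanisms \<alpha> \<beta> yA"
  shows "worst_case yP m' \<le> V yP m' (F_star yP yA)"
  unfolding worst_case_def
proof (rule cINF_lower[OF _ star_distribution(1)])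
  have "- (\<beta> - \<alpha>)\<^sup>2 \<le> payoff yP m' t t" if "t \<in> Theta" for t
    by (rule payoff_ge[OF IC_mechanism[OF assms] that]) (use ranges that in blast)
  then have "- (\<beta> - \<alpha>)\<^sup>2 \<le> V yP m' F" if "F \<in> cdfs" for F
    using that by (intro V_ge) auto
  then show "bdd_below (V yP m' ` cdfs)"
    by (intro bdd_belowI[of _ "- (\<beta> - \<alpha>)\<^sup>2"]) auto
qed

lemma star_worst_case: "worst_case yP m = - (d lo)\<^sup>2"
proof (rule antisym)
  show "worst_case yP m \<le> - (d lo)\<^sup>2"
    using worst_case_le[OF star_IC] V_star by simp
  show "- (d lo)\<^sup>2 \<le> worst_case yP m"
    unfolding worst_case_def
    by (rule cINF_greatest) (use star_distribution(1) V_ge star_payoff_ge in auto)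
qed

text \<open>The candidate attains the bound that \<open>F_star\<close> imposes on every incentive
  compatible mechanism, so the supremum is a maximum.\<close>

lemma star_robust_value: "robust_value \<alpha> \<beta> yP yA = - (d lo)\<^sup>2"
  unfolding robust_value_def
proof (rule cSup_eq_maximum)
  show "- (d lo)\<^sup>2 \<in> worst_case yP ` IC_mechanisms \<alpha> \<beta> yA"
    using star_IC star_worst_case by (metis image_eqI)
  show "x \<le> - (d lo)\<^sup>2" if "x \<in> worst_case yP ` IC_mechanisms \<alpha> \<beta> yA" for x
    using that worst_case_le V_star_le order_trans by blast
qed

lemma star_robustly_optimal: "robustly_optimal \<alpha> \<beta> yP yA m"
  unfolding robustly_optimal_def using star_IC star_worst_case star_robust_value by simp

end

end

theorem theorem1:
  fixes \<alpha> \<beta> :: real and yP yA :: "real \<Rightarrow> real" and m :: "real \<Rightarrow> real measure"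
  assumes "\<alpha> \<le> \<beta>"
    and "yP ` Theta \<subseteq> {\<alpha>..\<beta>}" and "yA ` Theta \<subseteq> {\<alpha>..\<beta>}"
    and "C1_on_Theta yP" and "C1_on_Theta yA"
    and "strict_mono_on Theta yP" and "strict_mono_on Theta yA"
    and "mono_on Theta (bias yP yA) \<or> antimono_on Theta (bias yP yA)"
    and "\<exists>\<^sub>\<le>\<^sub>1 \<theta>. \<theta> \<in> Theta \<and> bias yP yA \<theta> = 0"
    and "\<forall>\<theta>\<in>Theta. bias yP yA \<theta> \<ge> 0"
    and "\<exists>u v. u < v \<and> {u..v} \<subseteq> yP ` Theta \<inter> yA ` Theta"
    and "\<forall>\<theta>\<in>Theta. tau_star yP yA \<theta> \<le> (mu_star yP yA \<theta> - \<alpha>) * (\<beta> - mu_star yP yA \<theta>)"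
    and "m \<in> mechanisms \<alpha> \<beta>"
    and "\<forall>\<theta>\<in>Theta. mech_mean m \<theta> = mu_star yP yA \<theta>"
    and "\<forall>\<theta>\<in>Theta. mech_var m \<theta> = tau_star yP yA \<theta>"
  shows "robustly_optimal \<alpha> \<beta> yP yA m
    \<and> F_star yP yA \<in> cdfs
    \<and> robust_value \<alpha> \<beta> yP yA = V yP m (F_star yP yA)
    \<and> V yP m (F_star yP yA) = - (d_fun yP yA (theta_low yP yA))\<^sup>2"
proof -
  interpret biased_delegation yP yA
    by unfold_locales (use assms in auto)
  note star = \<open>yP ` Theta \<subseteq> {\<alpha>..\<beta>}\<close> \<open>m \<in> mechanisms \<alpha> \<beta>\<close> assms(14,15)[rule_format]
  show ?thesis
    using star_robustly_optimal[OF star] star_robust_value[OF star] V_star[OF star] star_distribution(1)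
    by simp
qed

end
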